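(* Consider the remotely powered channel described in the context and suppose that it has a precision charger, i.e. $\phi(\mathcal X)\subseteq\mathcal E$ (for every $x\in\mathcal X$ there is $e\in\mathcal E$ with $e=\phi(x)$). Then for every $\Gamma\ge0$, $$C_X(\Gamma)=C_M(\Gamma)=C_{\mathrm{ub}}(\Gamma),\qquad\text{where}\quad C_{\mathrm{ub}}(\Gamma)=\max_{p(x):\ \mathbb E[\phi(X)]\le\Gamma}I(X;Y).$$
   Context: Channel: $\mathcal X,\mathcal Y,\mathcal E$ are finite alphabets; $p(y|x)$ is a discrete memoryless channel from $\mathcal X$ to $\mathcal Y$; $\phi:\mathcal X\to[0,\infty)$ is an energy cost function; $\bar B$ is the battery capacity; $\mathcal E\subseteq[0,\bar B]$ is the energy alphabet. Assumptions: $\phi(x)\le\bar B$ for all $x$; there is a symbol $0\in\mathcal X$ with $\phi(0)=0$; $\mathcal E$ contains at least one strictly positive element. In $C_{\mathrm{ub}}$, $Y$ is the output of $p(y|x)$ with input $X\sim p(x)$. Energy constraints: the battery level $B_t$ satisfies $B_1=\bar B$, $B_{t+1}=\min\{B_t+E_t,\bar B\}-\phi(X_t)$, and the input must satisfy $\phi(X_t)\le\min\{B_t+E_t,\bar B\}$, where $E_t\in\mathcal E$ is the energy sent by the charger at time $t$. Cost constraint: $\frac1n\sum_{t=1}^nE_t\le\Gamma$. Codes: an $(R,n)$ code has message set $\mathcal M=\{1,\dots,2^{nR}\}$ (rounded to an integer), transmitter functions $f^{\mathrm{Tx}}_t:\mathcal M\times\mathcal E^t\to\mathcal X$ (so $x_t=f_t^{\mathrm{Tx}}(m,e^t)$)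 satisfying the energy constraint for every possible energy sequence produced by the charger, charger functions, and a decoder $\mathcal Y^n\to\mathcal M$ producing $\hat M$ from $Y^n$, where $Y_t$ is the output of $p(y|x)$ with input $X_t$. The charger functions are: $f^{\mathrm C}_t:\mathcal X^{t-1}\to\mathcal E$, $E_t=f_t^{\mathrm C}(X^{t-1})$ (charger adjacent to transmitter, capacity $C_X$); $f^{\mathrm C}:\mathcal M\to\mathcal E^n$, $E^n=f^{\mathrm C}(M)$ (fully cognitive charger, capacity $C_M$). The cost constraint must hold for every realization of the side information observed by the charger. The error probability is $P_e=|\mathcal M|^{-1}\sum_m\Pr(\hat M\ne m\mid m\text{ sent})$. A rate $R$ is achievable if there is a sequence of $(R,n)$ codes with $P_e\to0$ as $n\to\infty$; the capacity is the supremum of achievable rates. Logarithms are to base 2. *)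

theory Defs
  imports "HOL-Probability.Probability"
begin

text \<open>
  The input and output alphabets are finite types, the energy alphabet is a set of reals. Time runs
  over \<open>t < n\<close>, so index \<open>t\<close> stands for time \<open>t + 1\<close> in the usual one-based notation; for
  a sequence \<open>s\<close>, the history strictly before index \<open>t\<close> is a list of length \<open>t\<close>. Messages are
  \<open>1, ..., k\<close>.
\<close>

text \<open>
  A transmitter maps message, time index and \<open>e\<^sup>t\<close> (including the energy that arrives at the
  current time, hence a list of length \<open>t + 1\<close> at index \<open>t\<close>) to an input symbol. A charger maps
  message, time index and the past inputs to an energy; which of these arguments it may really use
  is restricted below.
\<close>

type_synonym 'x transmitter = "nat \<Rightarrow> nat \<Rightarrow> real list \<Rightarrow> 'x"
type_synonym 'x charger = "nat \<Rightarrow> nat \<Rightarrow> 'x list \<Rightarrow> real"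
type_synonym 'y decoder = "'y list \<Rightarrow> nat"

text \<open>Energies and inputs of the first \<open>t\<close> channel uses when message \<open>m\<close> is sent.\<close>

primrec run :: "'x transmitter \<Rightarrow> 'x charger \<Rightarrow> nat \<Rightarrow> nat \<Rightarrow> real list \<times> 'x list" where
  "run tx ch m 0 = ([], [])"
| "run tx ch m (Suc t) =
    (let (es, xs) = run tx ch m t; es' = es @ [ch m t xs] in (es', xs @ [tx m t es']))"

abbreviation energies :: "'x transmitter \<Rightarrow> 'x charger \<Rightarrow> nat \<Rightarrow> nat \<Rightarrow> real list" where
  "energies tx ch n m \<equiv> fst (run tx ch m n)"

abbreviation inputs :: "'x transmitter \<Rightarrow> 'x charger \<Rightarrow> nat \<Rightarrow> nat \<Rightarrow> 'x list" where
  "inputs tx ch n m \<equiv> snd (run tx ch m n)"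

primrec battery :: "('x \<Rightarrow> real) \<Rightarrow> real \<Rightarrow> real list \<Rightarrow> 'x list \<Rightarrow> nat \<Rightarrow> real" where
  "battery \<phi> Bmax es xs 0 = Bmax"
| "battery \<phi> Bmax es xs (Suc t) = min (battery \<phi> Bmax es xs t + es ! t) Bmax - \<phi> (xs ! t)"

definition energy_constraint ::
  "('x \<Rightarrow> real) \<Rightarrow> real \<Rightarrow> nat \<Rightarrow> real list \<Rightarrow> 'x list \<Rightarrow> bool" where
  "energy_constraint \<phi> Bmax n es xs \<longleftrightarrow>
    (\<forall>t<n. \<phi> (xs ! t) \<le> min (battery \<phi> Bmax es xs t + es ! t) Bmax)"

definition cost_constraint :: "real \<Rightarrow> nat \<Rightarrow> real list \<Rightarrow> bool" where
  "cost_constraint \<Gamma> n es \<longleftrightarrow> (1 / real n) * (\<Sum>t<n. es ! t) \<le> \<Gamma>"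

text \<open>
  Given the charger and the transmitter, everything the charger observes and produces is determined
  by the message. Hence the energy sequences that can occur, and the realizations of the side
  information, are those indexed by the messages.
\<close>

definition is_code ::
  "('x \<Rightarrow> real) \<Rightarrow> real \<Rightarrow> real \<Rightarrow> nat \<Rightarrow> nat \<Rightarrow> 'x transmitter \<Rightarrow> 'x charger \<Rightarrow> 'y decoder \<Rightarrow> bool" where
  "is_code \<phi> Bmax \<Gamma> n k tx ch dec \<longleftrightarrow>
    (\<forall>m\<in>{1..k}. energy_constraint \<phi> Bmax n (energies tx ch n m) (inputs tx ch n m)
               \<and> cost_constraint \<Gamma> n (energies tx ch n m))
    \<and> (\<forall>ys. length ys = n \<longrightarrow> dec ys \<in> {1..k})"

definition adjacent_chargers :: "real set \<Rightarrow> nat \<Rightarrow> nat \<Rightarrow> 'x charger set" where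
  "adjacent_chargers E n k =
    {(\<lambda>m t xs. g t xs) | g. \<forall>t<n. \<forall>xs. length xs = t \<longrightarrow> g t xs \<in> E}"

definition cognitive_chargers :: "real set \<Rightarrow> nat \<Rightarrow> nat \<Rightarrow> 'x charger set" where
  "cognitive_chargers E n k =
    {(\<lambda>m t xs. f m ! t) | f. \<forall>m\<in>{1..k}. length (f m) = n \<and> set (f m) \<subseteq> E}"

definition channel_output :: "('x \<Rightarrow> 'y pmf) \<Rightarrow> nat \<Rightarrow> 'x list \<Rightarrow> 'y list pmf" where
  "channel_output W n xs =
    map_pmf (\<lambda>y. map y [0..<n]) (Pi_pmf {..<n} undefined (\<lambda>t. W (xs ! t)))"

definition error_prob ::
  "('x \<Rightarrow> 'y pmf) \<Rightarrow> nat \<Rightarrow> nat \<Rightarrow> 'x transmitter \<Rightarrow> 'x charger \<Rightarrow> 'y decoder \<Rightarrow> real" where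
  "error_prob W n k tx ch dec =
    (1 / real k) * (\<Sum>m=1..k.
      measure_pmf.prob (channel_output W n (inputs tx ch n m)) {ys. dec ys \<noteq> m})"

definition num_messages :: "real \<Rightarrow> nat \<Rightarrow> nat" where
  "num_messages R n = nat \<lceil>2 powr (real n * R)\<rceil>"

text \<open>\<open>Ch n k\<close> is the set of admissible chargers for blocklength \<open>n\<close> and \<open>k\<close> messages.\<close>

definition achievable ::
  "('x \<Rightarrow> 'y pmf) \<Rightarrow> ('x \<Rightarrow> real) \<Rightarrow> real \<Rightarrow> (nat \<Rightarrow> nat \<Rightarrow> 'x charger set) \<Rightarrow> real \<Rightarrow> real \<Rightarrow> bool" where
  "achievable W \<phi> Bmax Ch \<Gamma> R \<longleftrightarrow> R \<ge> 0 \<and>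
    (\<exists>tx ch dec.
      (\<forall>n\<ge>1. ch n \<in> Ch n (num_messages R n)
           \<and> is_code \<phi> Bmax \<Gamma> n (num_messages R n) (tx n) (ch n) (dec n))
      \<and> (\<lambda>n. error_prob W n (num_messages R n) (tx n) (ch n) (dec n)) \<longlonglongrightarrow> 0)"

text \<open>
  Suprema are taken in the extended reals, so they are meaningful without a boundedness or
  nonemptiness side condition.
\<close>

definition capacity ::
  "('x \<Rightarrow> 'y pmf) \<Rightarrow> ('x \<Rightarrow> real) \<Rightarrow> real \<Rightarrow> (nat \<Rightarrow> nat \<Rightarrow> 'x charger set) \<Rightarrow> real \<Rightarrow> ereal" where
  "capacity W \<phi> Bmax Ch \<Gamma> = (SUP R\<in>{R. achievable W \<phi> Bmax Ch \<Gamma> R}. ereal R)"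

definition C_X ::
  "('x \<Rightarrow> 'y pmf) \<Rightarrow> ('x \<Rightarrow> real) \<Rightarrow> real \<Rightarrow> real set \<Rightarrow> real \<Rightarrow> ereal" where
  "C_X W \<phi> Bmax E \<Gamma> = capacity W \<phi> Bmax (adjacent_chargers E) \<Gamma>"

definition C_M ::
  "('x \<Rightarrow> 'y pmf) \<Rightarrow> ('x \<Rightarrow> real) \<Rightarrow> real \<Rightarrow> real set \<Rightarrow> real \<Rightarrow> ereal" where
  "C_M W \<phi> Bmax E \<Gamma> = capacity W \<phi> Bmax (cognitive_chargers E) \<Gamma>"

text \<open>The mutual information, in bits, of the input \<open>X \<sim> p\<close> and the output \<open>Y\<close> of the channel.\<close>

definition channel_information :: "('x \<Rightarrow> 'y pmf) \<Rightarrow> 'x pmf \<Rightarrow> real" where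
  "channel_information W p =
    prob_space.mutual_information
      (measure_pmf (bind_pmf p (\<lambda>x. map_pmf (Pair x) (W x))))
      2 (count_space UNIV) (count_space UNIV) fst snd"

definition input_distributions :: "('x \<Rightarrow> real) \<Rightarrow> real \<Rightarrow> 'x pmf set" where
  "input_distributions \<phi> \<Gamma> = {p. measure_pmf.expectation p \<phi> \<le> \<Gamma>}"

definition C_ub :: "('x \<Rightarrow> 'y pmf) \<Rightarrow> ('x \<Rightarrow> real) \<Rightarrow> real \<Rightarrow> ereal" where
  "C_ub W \<phi> \<Gamma> = (SUP p\<in>input_distributions \<phi> \<Gamma>. ereal (channel_information W p))"

end

theory Submission
  imports Defs "HOL-Real_Asymp.Real_Asymp"
begin

text \<open>
  A precision charger can send \<open>E\<^sub>t = \<phi>(X\<^sub>t\<^sub>-\<^sub>1)\<close>, which refills the battery exactly before every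
  transmission; so every codebook that meets the input cost constraint can be used, and a cognitive
  charger can imitate this. Conversely, by energy conservation the inputs spend at most the charged
  energy plus the initial battery content, which is negligible per channel use. What remains is
  the coding theorem with an input cost. Achievability is Feinstein's greedy construction, applied to
  an input law mixed with a little of the cost-free symbol so that the law of large numbers yields
  the cost constraint. For the converse, the output law of the empirical distribution of all code
  symbols serves as reference measure: the information densities of the codewords relative to
  it average to exactly \<open>n\<close> times its mutual information, so that neither the chain rule nor concavity
  is needed. Compactness of the probability simplex and continuity of mutual information remove the
  vanishing excess cost and give the maximum.
\<close>

subsection \<open>Mutual information on the probability simplex\<close>

text \<open>
  In nats. Meaningful only where \<open>pmf (W x) y\<close> and \<open>pmf q y\<close> are positive; elsewhere the junk
  value is \<open>ln 0 = 0\<close>, which is harmless since those points carry no mass.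
\<close>

definition info_density :: "('x \<Rightarrow> 'y pmf) \<Rightarrow> 'y pmf \<Rightarrow> 'x \<Rightarrow> 'y \<Rightarrow> real" where
  "info_density W q x y = ln (pmf (W x) y / pmf q y)"

lemma expectation_finite:
  fixes f :: "'a::finite \<Rightarrow> real"
  shows "measure_pmf.expectation p f = (\<Sum>x\<in>UNIV. pmf p x * f x)"
  by (subst integral_measure_pmf_real[of UNIV]) (auto simp: mult.commute)

lemma pmf_bind_finite:
  fixes p :: "'a::finite pmf"
  shows "pmf (bind_pmf p W) y = (\<Sum>x\<in>UNIV. pmf p x * pmf (W x) y)"
  by (simp add: pmf_bind expectation_finite)

lemma distributed_pmf:
  "distributed (measure_pmf J) (count_space UNIV) X (\<lambda>x. ennreal (pmf (map_pmf X J) x))"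
  unfolding distributed_def by (simp flip: map_pmf_rep_eq measure_pmf_eq_density)

lemma channel_information_sum:
  fixes W :: "'x::finite \<Rightarrow> 'y::finite pmf"
  shows "channel_information W p =
    (\<Sum>x\<in>UNIV. \<Sum>y\<in>UNIV. pmf p x * pmf (W x) y *
       log 2 (pmf p x * pmf (W x) y / (pmf p x * pmf (bind_pmf p W) y)))"
proof -
  define J where "J = bind_pmf p (\<lambda>x. map_pmf (Pair x) (W x))"
  interpret information_space "measure_pmf J" 2
    by standard simp
  have fst: "map_pmf fst J = p"
    by (simp add: J_def map_bind_pmf pmf.map_comp o_def bind_return_pmf')
  have snd: "map_pmf snd J = bind_pmf p W"
    by (simp add: J_def map_bind_pmf pmf.map_comp o_def pmf.map_ident)
  have J: "pmf J (x, y) = pmf p x * pmf (W x) y" for x y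
  proof -
    have "pmf (map_pmf (Pair x') (W x')) (x, y) = (if x' = x then pmf (W x) y else 0)" for x'
    proof (cases "x' = x")
      case True
      then show ?thesis by (simp add: pmf_map_inj' inj_on_def)
    next
      case False
      then show ?thesis by (auto simp: pmf_eq_0_set_pmf)
    qed
    note eq = this
    show ?thesis
      unfolding J_def pmf_bind_finite eq by (simp add: if_distrib cong: if_cong)
  qed
  have prod: "count_space (UNIV :: 'x set) \<Otimes>\<^sub>M count_space (UNIV :: 'y set) = count_space UNIV"
    by (subst pair_measure_count_space) auto
  have dist: "distributed (measure_pmf J) (count_space UNIV \<Otimes>\<^sub>M count_space UNIV)
     (\<lambda>z. (fst z, snd z)) (\<lambda>z. ennreal (pmf J z))"
    using distributed_pmf[of J "\<lambda>z. z"] by (simp add: prod)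
  have "channel_information W p =
    integral\<^sup>L (count_space UNIV \<Otimes>\<^sub>M count_space UNIV)
      (\<lambda>z. pmf J z * log 2 (pmf J z / (pmf p (fst z) * pmf (bind_pmf p W) (snd z))))"
    unfolding channel_information_def J_def[symmetric]
    by (rule mutual_information_distr)
      (use distributed_pmf[of J fst] distributed_pmf[of J snd] dist in
        \<open>auto simp: fst snd intro!: sigma_finite_measure_count_space_finite\<close>)
  also have "\<dots> = (\<Sum>z\<in>UNIV. pmf J z * log 2 (pmf J z / (pmf p (fst z) * pmf (bind_pmf p W) (snd z))))"
    unfolding prod by (simp add: lebesgue_integral_count_space_finite)
  also have "\<dots> = (\<Sum>x\<in>UNIV. \<Sum>y\<in>UNIV. pmf J (x, y) *
      log 2 (pmf J (x, y) / (pmf p x * pmf (bind_pmf p W) y)))"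
    by (simp add: sum.cartesian_product case_prod_unfold flip: UNIV_Times_UNIV)
  finally show ?thesis
    by (simp add: J)
qed

text \<open>The input probability cancels inside the logarithm wherever it is nonzero, and elsewhere
  the whole term vanishes. The factor \<open>ln 2\<close> converts bits to nats.\<close>

lemma channel_information_expectation:
  fixes W :: "'x::finite \<Rightarrow> 'y::finite pmf"
  shows "channel_information W p * ln 2 =
    measure_pmf.expectation p (\<lambda>x. measure_pmf.expectation (W x) (info_density W (bind_pmf p W) x))"
  unfolding channel_information_sum expectation_finite sum_distrib_left sum_distrib_right
  by (intro sum.cong refl) (auto simp: log_def info_density_def)

section \<open>Continuity of mutual information and compactness of the simplex\<close>

text \<open>Output entropy minus conditional output entropy, in nats. No quotient occurs, and
  \<open>v\<close> enters only linearly or through \<open>x * ln x\<close>, so continuity also holds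
  on the boundary of the simplex. Vectors replace pmfs so that the topology of Euclidean space
  applies.\<close>

definition vec_information :: "('x::finite \<Rightarrow> 'y::finite pmf) \<Rightarrow> real ^ 'x \<Rightarrow> real" where
  "vec_information W v =
     (\<Sum>x\<in>UNIV. v $ x * (\<Sum>y\<in>UNIV. pmf (W x) y * ln (pmf (W x) y))) -
     (\<Sum>y\<in>UNIV. (\<Sum>x\<in>UNIV. v $ x * pmf (W x) y) * ln (\<Sum>x\<in>UNIV. v $ x * pmf (W x) y))"

definition pmf_vec :: "'x::finite pmf \<Rightarrow> real ^ 'x" where
  "pmf_vec p = (\<chi> x. pmf p x)"

lemma channel_information_vec:
  fixes W :: "'x::finite \<Rightarrow> 'y::finite pmf"
  shows "channel_information W p * ln 2 = vec_information W (pmf_vec p)"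
proof -
  let ?q = "\<lambda>y. pmf (bind_pmf p W) y"
  have split: "pmf p x * (pmf (W x) y * info_density W (bind_pmf p W) x y) =
     pmf p x * (pmf (W x) y * ln (pmf (W x) y)) - pmf p x * pmf (W x) y * ln (?q y)" for x y
  \<comment> \<open>The logarithm of the quotient splits only if both parts are positive. If the
    joint mass is positive, so is the output mass, which dominates it.\<close>
  proof (cases "pmf p x * pmf (W x) y = 0")
    case False
    then have "0 < pmf p x * pmf (W x) y"
      by (simp add: less_le)
    also have "\<dots> \<le> ?q y"
      unfolding pmf_bind_finite by (intro member_le_sum) auto
    finally show ?thesis
      using False by (simp add: info_density_def ln_div pmf_pos right_diff_distrib)
  qed auto
  have "channel_information W p * ln 2 =
    (\<Sum>x\<in>UNIV. \<Sum>y\<in>UNIV. pmf p x * (pmf (W x) y * ln (pmf (W x) y))) -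
    (\<Sum>x\<in>UNIV. \<Sum>y\<in>UNIV. pmf p x * pmf (W x) y * ln (?q y))"
    unfolding channel_information_expectation expectation_finite
    by (simp add: sum_distrib_left split sum_subtractf)
  also have "(\<Sum>x\<in>UNIV. \<Sum>y\<in>UNIV. pmf p x * pmf (W x) y * ln (?q y)) =
      (\<Sum>y\<in>UNIV. ?q y * ln (?q y))"
    by (subst sum.swap) (simp add: pmf_bind_finite sum_distrib_right)
  finally show ?thesis
    by (simp add: vec_information_def pmf_vec_def pmf_bind_finite sum_distrib_left)
qed

lemma continuous_on_x_ln_x: "continuous_on {0..} (\<lambda>x::real. x * ln x)"
proof -
  \<comment> \<open>At 0 the factor 0 makes the value of \<open>ln 0\<close> irrelevant, so the
    function value agrees with the right-hand limit.\<close>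
  have "((\<lambda>x::real. x * ln x) \<longlongrightarrow> 0 * ln 0) (at 0 within {0..})"
  proof -
    have "((\<lambda>x::real. x * ln x) \<longlongrightarrow> 0) (at_right 0)"
      by real_asymp
    then show ?thesis
      by (simp add: at_within_Ici_at_right)
  qed
  moreover have "((\<lambda>x::real. x * ln x) \<longlongrightarrow> t * ln t) (at t within {0..})" if "t > 0" for t
    using that by (intro tendsto_intros) auto
  ultimately show ?thesis
    unfolding continuous_on_def by (metis atLeast_iff le_less)
qed

definition prob_simplex :: "(real ^ 'x::finite) set" where
  "prob_simplex = {v. (\<forall>x. 0 \<le> v $ x) \<and> (\<Sum>x\<in>UNIV. v $ x) = 1}"

lemma pmf_vec_image: "range pmf_vec = prob_simplex"
proof (intro subset_antisym subsetI)
  fix v :: "real ^ 'x"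
  assume v: "v \<in> prob_simplex"
  have "pmf (embed_pmf (\<lambda>x. v $ x)) x = v $ x" for x
    using v by (intro pmf_embed_pmf)
      (auto simp: prob_simplex_def nn_integral_count_space_finite simp flip: ennreal_1)
  then have "pmf_vec (embed_pmf (\<lambda>x. v $ x)) = v"
    by (simp add: pmf_vec_def vec_eq_iff)
  then show "v \<in> range pmf_vec"
    by (metis rangeI)
qed (auto simp: prob_simplex_def pmf_vec_def sum_pmf_eq_1)

lemma compact_prob_simplex: "compact (prob_simplex :: (real ^ 'x::finite) set)"
proof -
  have "closed (prob_simplex :: (real ^ 'x) set)"
    unfolding prob_simplex_def
    by (intro closed_Collect_conj closed_Collect_all closed_Collect_le closed_Collect_eq
        continuous_intros)
  moreover have "norm v \<le> 1" if "v \<in> prob_simplex" for v :: "real ^ 'x"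
    using norm_le_l1_cart[of v] that by (simp add: prob_simplex_def)
  then have "bounded (prob_simplex :: (real ^ 'x) set)"
    by (auto simp: bounded_iff)
  ultimately show ?thesis
    by (simp add: compact_eq_bounded_closed)
qed

lemma continuous_on_vec_information: "continuous_on prob_simplex (vec_information W)"
  unfolding vec_information_def
  by (intro continuous_intros continuous_on_compose2[OF continuous_on_x_ln_x])
    (auto simp: prob_simplex_def intro!: sum_nonneg)

text \<open>Sequential compactness of the simplex, carried back to pmfs. Convergence is expressed
  through expectations, which on a finite alphabet determine the limit law and also transfer the
  cost constraint to it.\<close>

lemma pmf_convergent_subseq:
  fixes W :: "'x::finite \<Rightarrow> 'y::finite pmf" and p :: "nat \<Rightarrow> 'x pmf"
  obtains l r where "strict_mono r"
    "\<And>f :: 'x \<Rightarrow> real. (\<lambda>n. measure_pmf.expectation (p (r n)) f) \<longlonglongrightarrow> measure_pmf.expectation l f"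
    "(\<lambda>n. channel_information W (p (r n))) \<longlonglongrightarrow> channel_information W l"
proof -
  have "\<And>n. pmf_vec (p n) \<in> prob_simplex"
    using pmf_vec_image by blast
  then obtain v r where v: "v \<in> prob_simplex" "strict_mono r"
      "((\<lambda>n. pmf_vec (p n)) \<circ> r) \<longlonglongrightarrow> v"
    using seq_compactE[OF compact_imp_seq_compact[OF compact_prob_simplex]] by metis
  obtain l where l: "v = pmf_vec l"
    using v(1) pmf_vec_image by blast
  have lim: "(\<lambda>n. pmf_vec (p (r n))) \<longlonglongrightarrow> pmf_vec l"
    using v(3) by (simp add: o_def l)
  have "(\<lambda>n. vec_information W (pmf_vec (p (r n)))) \<longlonglongrightarrow> vec_information W (pmf_vec l)"
    using continuous_on_tendsto_compose[OF continuous_on_vec_information lim] pmf_vec_image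
    by (metis (mono_tags, lifting) always_eventually rangeI)
  then have "(\<lambda>n. channel_information W (p (r n)) * ln 2 / ln 2) \<longlonglongrightarrow>
      channel_information W l * ln 2 / ln 2"
    unfolding channel_information_vec by (rule tendsto_divide) auto
  then have "(\<lambda>n. channel_information W (p (r n))) \<longlonglongrightarrow> channel_information W l"
    by simp
  moreover have "(\<lambda>n. measure_pmf.expectation (p (r n)) f) \<longlonglongrightarrow> measure_pmf.expectation l f"
    for f :: "'x \<Rightarrow> real"
    using tendsto_vec_nth[OF lim] unfolding expectation_finite pmf_vec_def
    by (intro tendsto_intros) auto
  ultimately show ?thesis
    using v(2) that by blast
qed

subsection \<open>Feinstein's construction for memoryless channels\<close>

text \<open>Codewords are chosen greedily, each decoding set being \<open>B x\<close> minus the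
  earlier ones. At most \<open>M\<close> sets of output mass at most \<open>c\<close> are ever
  removed, so the mass in \<open>good\<close> exceeds by more than \<open>1 - \<epsilon>\<close>
  what removal can destroy.\<close>

lemma feinstein:
  fixes P :: "'a pmf" and V :: "'a \<Rightarrow> 'b pmf" and A :: "'a set" and B :: "'a \<Rightarrow> 'b set"
  assumes "A \<noteq> {}"
    and c: "\<And>x. x \<in> A \<Longrightarrow> measure_pmf.prob (bind_pmf P V) (B x) \<le> c"
    and good: "1 - \<epsilon> + real M * c <
      measure_pmf.prob (bind_pmf P (\<lambda>x. map_pmf (Pair x) (V x))) {z. fst z \<in> A \<and> snd z \<in> B (fst z)}"
  shows "\<exists>f D. (\<forall>i\<in>{1..M}. f i \<in> A \<and> 1 - \<epsilon> \<le> measure_pmf.prob (V (f i)) (D i)) \<and>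
    disjoint_family_on D {1..M}"
proof -
  define Q where "Q = bind_pmf P V"
  define J where "J = bind_pmf P (\<lambda>x. map_pmf (Pair x) (V x))"
  have "0 \<le> c"
    using assms(1) c by (meson ex_in_conv measure_nonneg order_trans)
  \<comment> \<open>A codeword can be added as long as the decoding sets used so far have small output probability:
    otherwise no input word in \<open>A\<close> would keep enough probability in its set after removing them.\<close>
  have extend: "\<exists>x\<in>A. 1 - \<epsilon> \<le> measure_pmf.prob (V x) (B x - S)"
    if S: "measure_pmf.prob Q S \<le> real M * c" for S
  proof (rule ccontr)
    assume "\<not> ?thesis"
    then have less: "\<And>x. x \<in> A \<Longrightarrow> measure_pmf.prob (V x) (B x - S) < 1 - \<epsilon>"
      by force
    with \<open>A \<noteq> {}\<close> have "0 \<le> 1 - \<epsilon>"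
      by (meson ex_in_conv measure_nonneg order.strict_trans1 less_imp_le)
    \<comment> \<open>Averaging the assumed failure over the input gives this event mass at most
      \<open>1 - \<epsilon>\<close>. Restoring the outputs in \<open>S\<close> adds at most
      \<open>M * c\<close>, contradicting \<open>good\<close>.\<close>
    let ?G = "{z. fst z \<in> A \<and> snd z \<in> B (fst z) - S}"
    have "emeasure J ?G = (\<integral>\<^sup>+ x. emeasure (V x) (Pair x -` ?G) \<partial>P)"
      by (simp add: J_def)
    also have "\<dots> \<le> (\<integral>\<^sup>+ x. ennreal (1 - \<epsilon>) \<partial>P)"
    proof (rule nn_integral_mono)
      fix x
      show "emeasure (V x) (Pair x -` ?G) \<le> ennreal (1 - \<epsilon>)"
      proof (cases "x \<in> A")
        case True
        then have "Pair x -` ?G = B x - S"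
          by auto
        with less[OF True] show ?thesis
          by (simp add: measure_pmf.emeasure_eq_measure ennreal_leI)
      next
        case False
        then have "Pair x -` ?G = {}"
          by auto
        then show ?thesis
          by (metis emeasure_empty zero_le)
      qed
    qed
    finally have "measure_pmf.prob J ?G \<le> 1 - \<epsilon>"
      using \<open>0 \<le> 1 - \<epsilon>\<close> by (simp add: measure_pmf.emeasure_eq_measure)
    moreover have "measure_pmf.prob J {z. fst z \<in> A \<and> snd z \<in> B (fst z)} \<le>
        measure_pmf.prob J ?G + measure_pmf.prob J (snd -` S)"
      by (rule order_trans[OF measure_pmf.finite_measure_mono measure_Un_le]) auto
    moreover have "map_pmf snd J = Q"
      by (simp add: J_def Q_def map_bind_pmf pmf.map_comp o_def pmf.map_ident)
    then have "measure_pmf.prob J (snd -` S) = measure_pmf.prob Q S"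
      by (metis measure_map_pmf)
    ultimately show False
      using good S unfolding J_def by linarith
  qed
  \<comment> \<open>The inclusion of \<open>D i\<close> in \<open>B (f i)\<close> is carried through
    the induction because it bounds the output mass of \<open>D i\<close> by
    \<open>c\<close>.\<close>
  have "\<exists>f D. (\<forall>i\<in>{1..j}. f i \<in> A \<and> D i \<subseteq> B (f i) \<and> 1 - \<epsilon> \<le> measure_pmf.prob (V (f i)) (D i)) \<and>
    disjoint_family_on D {1..j}" if "j \<le> M" for j
    using that
  proof (induction j)
    case 0
    show ?case
      by (simp add: disjoint_family_on_def)
  next
    case (Suc j)
    then have "j \<le> M"
      by simp
    from Suc.IH[OF this] obtain f D where
      fD: "\<forall>i\<in>{1..j}. f i \<in> A \<and> D i \<subseteq> B (f i) \<and> 1 - \<epsilon> \<le> measure_pmf.prob (V (f i)) (D i)"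
      and disj: "disjoint_family_on D {1..j}"
      by blast
    let ?S = "\<Union>i\<in>{1..j}. D i"
    have "measure_pmf.prob Q ?S \<le> (\<Sum>i\<in>{1..j}. measure_pmf.prob Q (D i))"
      by (rule measure_UNION_le) auto
    also have "\<dots> \<le> (\<Sum>i\<in>{1..j}. c)"
    proof (rule sum_mono)
      fix i assume "i \<in> {1..j}"
      then have "D i \<subseteq> B (f i)" "f i \<in> A"
        using fD by auto
      then show "measure_pmf.prob Q (D i) \<le> c"
        using c[of "f i"] measure_pmf.finite_measure_mono[of "D i" "B (f i)" Q]
        by (auto simp: Q_def)
    qed
    also have "\<dots> \<le> real M * c"
      using Suc.prems \<open>0 \<le> c\<close> by (simp add: mult_right_mono)
    finally obtain x where x: "x \<in> A" "1 - \<epsilon> \<le> measure_pmf.prob (V x) (B x - ?S)"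
      using extend by blast
    let ?f = "f(Suc j := x)" and ?D = "D(Suc j := B x - ?S)"
    have "\<forall>i\<in>{1..Suc j}. ?f i \<in> A \<and> ?D i \<subseteq> B (?f i) \<and> 1 - \<epsilon> \<le> measure_pmf.prob (V (?f i)) (?D i)"
      using fD x by auto
    moreover have "disjoint_family_on ?D {1..Suc j}"
      using disj unfolding disjoint_family_on_def by (fastforce simp: le_Suc_eq)
    ultimately show ?case
      by blast
  qed
  then show ?thesis
    by blast
qed

section \<open>Concentration and product laws\<close>

lemma expectation_Pi_pmf_component:
  fixes f :: "'a \<Rightarrow> real"
  assumes "finite A" "t \<in> A"
  shows "measure_pmf.expectation (Pi_pmf A d P) (\<lambda>z. f (z t)) = measure_pmf.expectation (P t) f"
proof -
  have "measure_pmf.expectation (P t) f =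
      measure_pmf.expectation (map_pmf (\<lambda>z. z t) (Pi_pmf A d P)) f"
    using assms by (simp only: Pi_pmf_component if_True)
  then show ?thesis
    by simp
qed

text \<open>The weak law of large numbers for bounded functions, obtained from Hoeffding's
  inequality.\<close>

lemma prob_deviation_tendsto_0:
  fixes J :: "'a::finite pmf" and f :: "'a \<Rightarrow> real"
  assumes "\<delta> > 0"
  shows "(\<lambda>n. measure_pmf.prob (Pi_pmf {..<n} d (\<lambda>_. J))
    {z. real n * \<delta> \<le> \<bar>(\<Sum>t<n. f (z t)) - real n * measure_pmf.expectation J f\<bar>}) \<longlonglongrightarrow> 0"
    (is "?p \<longlonglongrightarrow> 0")
proof -
  \<comment> \<open>A uniform bound exists because the alphabet is finite. Adding 1 keeps it
    positive even for \<open>f = 0\<close>, so that it may be a divisor.\<close>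
  define b where "b = (\<Sum>x\<in>UNIV. \<bar>f x\<bar>) + 1"
  have f: "- b \<le> f x \<and> f x \<le> b" for x
    using member_le_sum[of x UNIV "\<lambda>x. \<bar>f x\<bar>"] by (auto simp: b_def abs_le_iff)
  have "b > 0"
    unfolding b_def by (intro add_nonneg_pos sum_nonneg) auto
  have bound: "?p n \<le> 2 * exp (- (real n * (\<delta>\<^sup>2 / (2 * b\<^sup>2))))" if "n > 0" for n
  proof -
    let ?M = "Pi_pmf {..<n} d (\<lambda>_. J)"
    have mean: "measure_pmf.expectation ?M (\<lambda>z. f (z t)) = measure_pmf.expectation J f" if "t < n" for t
      using that by (simp add: expectation_Pi_pmf_component)
    interpret Hoeffding_ineq "measure_pmf ?M" "{..<n}" "\<lambda>t z. f (z t)" "\<lambda>_. - b" "\<lambda>_. b"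
      "\<Sum>t<n. measure_pmf.expectation ?M (\<lambda>z. f (z t))"
    proof unfold_locales
      show "prob_space.indep_vars (measure_pmf ?M) (\<lambda>_. borel) (\<lambda>t z. f (z t)) {..<n}"
        by (rule prob_space.indep_vars_compose2[OF measure_pmf.prob_space_axioms
              indep_vars_Pi_pmf]) auto
    qed (use f in auto)
    have "?p n \<le> 2 * exp (- 2 * (real n * \<delta>)\<^sup>2 / (\<Sum>t<n. (b - - b)\<^sup>2))"
      using Hoeffding_ineq_abs_ge[of "real n * \<delta>"] \<open>b > 0\<close> \<open>\<delta> > 0\<close> \<open>n > 0\<close>
      by (simp add: mean)
    also have "- 2 * (real n * \<delta>)\<^sup>2 / (\<Sum>t<n. (b - - b)\<^sup>2) = - (real n * (\<delta>\<^sup>2 / (2 * b\<^sup>2)))"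
      using \<open>b > 0\<close> \<open>n > 0\<close> by (simp add: field_simps power2_eq_square)
    finally show ?thesis .
  qed
  have exp: "(\<lambda>n. 2 * exp (- (real n * a))) \<longlonglongrightarrow> 0" if "a > 0" for a
    using that by real_asymp
  show ?thesis
  proof (rule tendsto_sandwich[OF _ _ tendsto_const exp[of "\<delta>\<^sup>2 / (2 * b\<^sup>2)"]])
    show "\<forall>\<^sub>F n in sequentially. ?p n \<le> 2 * exp (- (real n * (\<delta>\<^sup>2 / (2 * b\<^sup>2))))"
      by (rule eventually_sequentiallyI[of 1]) (rule bound, simp)
  qed (use \<open>b > 0\<close> \<open>\<delta> > 0\<close> in auto)
qed

text \<open>Sending an i.i.d. block through the memoryless channel amounts to drawing i.i.d.
  input-output pairs and unzipping them. This makes the law of large numbers applicable to sums of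
  information densities.\<close>

lemma Pi_pmf_pair:
  assumes "finite A"
  shows "bind_pmf (Pi_pmf A d1 (\<lambda>_. p)) (\<lambda>x. map_pmf (Pair x) (Pi_pmf A d2 (\<lambda>t. W (x t)))) =
    map_pmf (\<lambda>z. (fst \<circ> z, snd \<circ> z))
      (Pi_pmf A (d1, d2) (\<lambda>_. bind_pmf p (\<lambda>x. map_pmf (Pair x) (W x))))"
proof -
  have "Pi_pmf A (d1, d2) (\<lambda>_. bind_pmf p (\<lambda>x. map_pmf (Pair x) (W x))) =
    bind_pmf (Pi_pmf A d1 (\<lambda>_. p)) (\<lambda>x. bind_pmf (Pi_pmf A d2 (\<lambda>t. W (x t)))
      (\<lambda>y. Pi_pmf A (d1, d2) (\<lambda>t. return_pmf (x t, y t))))"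
    unfolding map_pmf_def
    by (subst Pi_pmf_bind[OF assms, where d' = d1], subst Pi_pmf_bind[OF assms, where d' = d2]) simp
  then show ?thesis
    using assms
    by (auto simp: map_bind_pmf map_pmf_def bind_assoc_pmf bind_return_pmf set_Pi_pmf PiE_dflt_def
        fun_eq_iff intro!: bind_pmf_cong)
qed

lemma measure_pmf_le_of_pmf_le:
  assumes "\<And>y. y \<in> B \<Longrightarrow> c * pmf Q y \<le> pmf V y"
  shows "c * measure_pmf.prob Q B \<le> measure_pmf.prob V B"
proof -
  have "c * measure_pmf.prob Q B = infsetsum (\<lambda>y. c * pmf Q y) B"
    by (simp add: measure_pmf_conv_infsetsum infsetsum_cmult_right pmf_abs_summable)
  also have "\<dots> \<le> infsetsum (pmf V) B"
    by (intro infsetsum_mono assms abs_summable_on_cmult_right pmf_abs_summable)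
  finally show ?thesis
    by (simp add: measure_pmf_conv_infsetsum)
qed

text \<open>Feinstein's construction with likelihood-ratio thresholds: a set on which the channel
  law is at least \<open>exp \<tau>\<close> times the output law has output mass at most
  \<open>exp (- \<tau>)\<close>, whatever the input word.\<close>

lemma block_code_exists:
  fixes W :: "'x::finite \<Rightarrow> 'y::finite pmf" and p :: "'x pmf" and A :: "(nat \<Rightarrow> 'x) set"
  defines "q \<equiv> bind_pmf p W"
    and "J \<equiv> bind_pmf p (\<lambda>x. map_pmf (Pair x) (W x))"
  assumes "A \<noteq> {}" and "M \<ge> 1"
    and good: "1 - \<epsilon> + real M * exp (- \<tau>) <
      measure_pmf.prob (Pi_pmf {..<n} (undefined, undefined) (\<lambda>_. J))
        {z. fst \<circ> z \<in> A \<and> \<tau> \<le> (\<Sum>t<n. info_density W q (fst (z t)) (snd (z t)))}"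
  shows "\<exists>c dec. (\<forall>m\<in>{1..M}. c m \<in> A \<and>
      measure_pmf.prob (channel_output W n (map (c m) [0..<n])) {ys. dec ys \<noteq> m} \<le> \<epsilon>) \<and>
    (\<forall>ys. dec ys \<in> {1..M})"
proof -
  define P where "P = Pi_pmf {..<n} undefined (\<lambda>_. p)"
  define V where "V x = Pi_pmf {..<n} undefined (\<lambda>t. W (x t))" for x
  define Q where "Q = bind_pmf P V"
  define B where "B x = {y. exp \<tau> * pmf Q y \<le> pmf (V x) y}" for x
  define JJ where "JJ = Pi_pmf {..<n} (undefined, undefined) (\<lambda>_. J)"
  have Q: "Q = Pi_pmf {..<n} undefined (\<lambda>_. q)"
    unfolding Q_def P_def V_def q_def by (rule Pi_pmf_bind[symmetric]) simp
  have joint: "bind_pmf P (\<lambda>x. map_pmf (Pair x) (V x)) = map_pmf (\<lambda>z. (fst \<circ> z, snd \<circ> z)) JJ"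
    unfolding P_def V_def JJ_def J_def by (rule Pi_pmf_pair) simp
  have QB: "measure_pmf.prob (bind_pmf P V) (B x) \<le> exp (- \<tau>)" for x
  proof -
    have "exp \<tau> * measure_pmf.prob Q (B x) \<le> measure_pmf.prob (V x) (B x)"
      by (rule measure_pmf_le_of_pmf_le) (simp add: B_def)
    also have "\<dots> \<le> 1"
      by simp
    finally show ?thesis
      unfolding Q_def by (simp add: exp_minus field_simps)
  qed
  \<comment> \<open>On the support of the joint law all factors are positive, so the exponential of
    the summed densities is the true likelihood ratio.\<close>
  have inB: "snd \<circ> z \<in> B (fst \<circ> z)"
    if z: "z \<in> set_pmf JJ" and \<tau>: "\<tau> \<le> (\<Sum>t<n. info_density W q (fst (z t)) (snd (z t)))" for z
  proof -
    have zJ: "z t \<in> set_pmf J" if "t < n" for t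
      using z that by (auto simp: JJ_def set_Pi_pmf PiE_dflt_def)
    have z0: "z t = (undefined, undefined)" if "\<not> t < n" for t
      using z that by (auto simp: JJ_def set_Pi_pmf PiE_dflt_def)
    have pos: "0 < pmf (W (fst (z t))) (snd (z t))" "0 < pmf q (snd (z t))" if "t < n" for t
      using zJ[OF that] by (auto simp: J_def q_def pmf_positive_iff)
    have VV: "pmf (V (fst \<circ> z)) (snd \<circ> z) = (\<Prod>t<n. pmf (W (fst (z t))) (snd (z t)))"
      unfolding V_def using z0 by (subst pmf_Pi') auto
    have QQ: "pmf Q (snd \<circ> z) = (\<Prod>t<n. pmf q (snd (z t)))"
      unfolding Q using z0 by (subst pmf_Pi') auto
    have "exp \<tau> * pmf Q (snd \<circ> z) \<le>
      exp (\<Sum>t<n. info_density W q (fst (z t)) (snd (z t))) * pmf Q (snd \<circ> z)"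
      using \<tau> by (intro mult_right_mono) auto
    also have "\<dots> = (\<Prod>t<n. exp (info_density W q (fst (z t)) (snd (z t))) * pmf q (snd (z t)))"
      by (simp add: QQ exp_sum prod.distrib)
    also have "\<dots> = (\<Prod>t<n. pmf (W (fst (z t))) (snd (z t)))"
      using pos by (intro prod.cong) (auto simp: info_density_def less_imp_neq[symmetric])
    finally show ?thesis
      by (simp add: B_def VV)
  qed
  have "1 - \<epsilon> + real M * exp (- \<tau>) <
    measure_pmf.prob (bind_pmf P (\<lambda>x. map_pmf (Pair x) (V x))) {z. fst z \<in> A \<and> snd z \<in> B (fst z)}"
    unfolding joint measure_map_pmf
    by (rule order.strict_trans2[OF good[folded JJ_def]], rule measure_pmf.finite_measure_mono_AE)
      (auto simp: AE_measure_pmf_iff inB)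
  from feinstein[OF \<open>A \<noteq> {}\<close> QB this] obtain c D where
    c: "\<And>m. m \<in> {1..M} \<Longrightarrow> c m \<in> A \<and> 1 - \<epsilon> \<le> measure_pmf.prob (V (c m)) (D m)"
    and disj: "disjoint_family_on D {1..M}"
    by blast
  \<comment> \<open>Decoders read lists, whereas the decoding sets consist of functions equal to
    \<open>undefined\<close> from \<open>n\<close> on. This map translates between the two. The
    decoder's fallback value 1 is a legal message because \<open>M \<ge> 1\<close>.\<close>
  define ext where "ext ys = (\<lambda>t. if t < n then ys ! t else undefined)" for ys :: "'y list"
  define dec where "dec ys = (if \<exists>m\<in>{1..M}. ext ys \<in> D m then SOME m. m \<in> {1..M} \<and> ext ys \<in> D m else 1)" for ys
  have dec_some: "dec ys \<in> {1..M} \<and> ext ys \<in> D (dec ys)" if "\<exists>m\<in>{1..M}. ext ys \<in> D m" for ys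
    unfolding dec_def if_P[OF that]
    by (rule someI_ex[of "\<lambda>m. m \<in> {1..M} \<and> ext ys \<in> D m"]) (use that in blast)
  have dec_range: "dec ys \<in> {1..M}" for ys
    using dec_some \<open>M \<ge> 1\<close> by (cases "\<exists>m\<in>{1..M}. ext ys \<in> D m") (auto simp: dec_def)
  have dec_eq: "dec ys = m" if "m \<in> {1..M}" "ext ys \<in> D m" for ys m
    using dec_some[of ys] that disj unfolding disjoint_family_on_def by blast
  have "measure_pmf.prob (channel_output W n (map (c m) [0..<n])) {ys. dec ys \<noteq> m} \<le> \<epsilon>"
    if m: "m \<in> {1..M}" for m
  proof -
    have "Pi_pmf {..<n} undefined (\<lambda>t. W (map (c m) [0..<n] ! t)) = V (c m)"
      unfolding V_def by (rule Pi_pmf_cong) auto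
    then have "measure_pmf.prob (channel_output W n (map (c m) [0..<n])) {ys. dec ys \<noteq> m} =
      measure_pmf.prob (V (c m)) {y. dec (map y [0..<n]) \<noteq> m}"
      by (simp add: channel_output_def vimage_def)
    also have "\<dots> \<le> measure_pmf.prob (V (c m)) (- D m)"
    proof (rule measure_pmf.finite_measure_mono_AE)
      have "ext (map y [0..<n]) = y" if "y \<in> set_pmf (V (c m))" for y
        using that by (auto simp: V_def set_Pi_pmf PiE_dflt_def ext_def fun_eq_iff)
      then show "AE y in V (c m). y \<in> {y. dec (map y [0..<n]) \<noteq> m} \<longrightarrow> y \<in> - D m"
        using dec_eq[OF m] by (auto simp: AE_measure_pmf_iff)
    qed auto
    also have "\<dots> = 1 - measure_pmf.prob (V (c m)) (D m)"
      using measure_pmf.prob_compl[of "D m" "V (c m)"] by (simp add: Compl_eq_Diff_UNIV)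
    finally show ?thesis
      using c[OF m] by linarith
  qed
  then show ?thesis
    using c dec_range by blast
qed

subsection \<open>Transmitters and chargers\<close>

lemma run_snoc:
  "energies tx ch (Suc t) m = energies tx ch t m @ [ch m t (inputs tx ch t m)]"
  "inputs tx ch (Suc t) m = inputs tx ch t m @ [tx m t (energies tx ch (Suc t) m)]"
  by (simp_all add: Let_def split: prod.split)

lemma length_run [simp]:
  "length (energies tx ch t m) = t" "length (inputs tx ch t m) = t"
  by (induction t) (simp_all only: run_snoc length_append, simp_all)

lemma nth_energies:
  assumes "t < n"
  shows "energies tx ch n m ! t = ch m t (inputs tx ch t m)"
  using assms
  by (induction n) (auto simp: run_snoc nth_append less_Suc_eq simp del: run.simps(2))

text \<open>Agreement is asked only on the histories that actually occur: a precomputed energy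
  sequence imitates a feedback charger along the run, but not on other histories.\<close>

lemma run_cong:
  assumes "\<And>t. t < n \<Longrightarrow> ch' m t (inputs tx ch t m) = ch m t (inputs tx ch t m)"
  shows "run tx ch' m n = run tx ch m n"
  using assms by (induction n) (auto simp: Let_def case_prod_unfold)

text \<open>No channel output reaches the transmitter or the charger, so the message fixes the whole
  run. A charger that knows the message can therefore compute in advance every energy that the
  adjacent one would send.\<close>

lemma achievable_cognitive_if_adjacent:
  assumes "achievable W \<phi> Bmax (adjacent_chargers E) \<Gamma> R"
  shows "achievable W \<phi> Bmax (cognitive_chargers E) \<Gamma> R"
proof -
  from assms obtain tx ch dec where R: "R \<ge> 0"
    and ch: "\<And>n. n \<ge> 1 \<Longrightarrow> ch n \<in> adjacent_chargers E n (num_messages R n)"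
    and code: "\<And>n. n \<ge> 1 \<Longrightarrow> is_code \<phi> Bmax \<Gamma> n (num_messages R n) (tx n) (ch n) (dec n)"
    and lim: "(\<lambda>n. error_prob W n (num_messages R n) (tx n) (ch n) (dec n)) \<longlonglongrightarrow> 0"
    unfolding achievable_def by blast
  define ch' where "ch' n = (\<lambda>m t (_ :: 'a list). energies (tx n) (ch n) n m ! t)" for n
  have run: "run (tx n) (ch' n) m n = run (tx n) (ch n) m n" for n m
    by (rule run_cong) (simp add: ch'_def nth_energies)
  have "ch' n \<in> cognitive_chargers E n (num_messages R n)" if n: "n \<ge> 1" for n
  proof -
    obtain g where g: "ch n = (\<lambda>m t xs. g t xs)" "\<And>t xs. t < n \<Longrightarrow> length xs = t \<Longrightarrow> g t xs \<in> E"
      using ch[OF n] unfolding adjacent_chargers_def by blast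
    have "set (energies (tx n) (ch n) n m) \<subseteq> E" for m
      using g by (auto simp: in_set_conv_nth nth_energies)
    then show ?thesis
      unfolding cognitive_chargers_def ch'_def by fastforce
  qed
  moreover have "is_code \<phi> Bmax \<Gamma> n (num_messages R n) (tx n) (ch' n) (dec n)" if "n \<ge> 1" for n
    using code[OF that] by (simp add: is_code_def run)
  moreover have "(\<lambda>n. error_prob W n (num_messages R n) (tx n) (ch' n) (dec n)) \<longlonglongrightarrow> 0"
    using lim by (simp add: error_prob_def run)
  ultimately show ?thesis
    using R unfolding achievable_def by blast
qed

definition codebook_transmitter :: "(nat \<Rightarrow> nat \<Rightarrow> 'x) \<Rightarrow> 'x transmitter" where
  "codebook_transmitter c = (\<lambda>m t es. c m t)"

text \<open>At index 0 the battery is still full, so nothing is sent; afterwards entry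
  \<open>t - 1\<close> is the most recent input.\<close>

definition recharge :: "('x \<Rightarrow> real) \<Rightarrow> 'x charger" where
  "recharge \<phi> = (\<lambda>m t xs. if t = 0 then 0 else \<phi> (xs ! (t - 1)))"

lemma inputs_codebook: "inputs (codebook_transmitter c) ch n m = map (c m) [0..<n]"
  by (induction n) (simp_all add: run_snoc codebook_transmitter_def del: run.simps(2))

lemma is_code_recharge:
  assumes "\<And>x. 0 \<le> \<phi> x" "\<And>x. \<phi> x \<le> Bmax" "n \<ge> 1"
    and cost: "\<And>m. m \<in> {1..k} \<Longrightarrow> (\<Sum>t<n. \<phi> (c m t)) \<le> real n * \<Gamma>"
    and dec: "\<And>ys. dec ys \<in> {1..k}"
  shows "is_code \<phi> Bmax \<Gamma> n k (codebook_transmitter c) (recharge \<phi>) dec"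
proof -
  let ?es = "\<lambda>m. energies (codebook_transmitter c) (recharge \<phi>) n m"
  let ?xs = "\<lambda>m. map (c m) [0..<n]"
  have es: "?es m ! t = (if t = 0 then 0 else \<phi> (c m (t - 1)))" if "t < n" for m t
    using that by (simp add: nth_energies inputs_codebook recharge_def)
  \<comment> \<open>Only the latest input is missing from the battery, and the next arrival restores
    it exactly. Hence \<open>Bmax\<close> is available before each transmission, and every input is
    admissible.\<close>
  have "battery \<phi> Bmax (?es m) (?xs m) t = Bmax - (if t = 0 then 0 else \<phi> (c m (t - 1)))"
    if "t \<le> n" for m t
    using that by (induction t) (auto simp: es)
  then have "energy_constraint \<phi> Bmax n (?es m) (?xs m)" for m
    using assms(2) by (simp add: energy_constraint_def es)
  moreover have "cost_constraint \<Gamma> n (?es m)" if "m \<in> {1..k}" for m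
  proof -
    obtain n' where n: "n = Suc n'"
      using \<open>n \<ge> 1\<close> by (cases n) auto
    \<comment> \<open>Arrivals lag inputs by one step, so the last input is never refunded.\<close>
    have "(\<Sum>t<n. ?es m ! t) = (\<Sum>t<n'. \<phi> (c m t))"
      unfolding n sum.lessThan_Suc_shift by (simp add: es[unfolded n] del: run.simps(2))
    also have "\<dots> \<le> (\<Sum>t<n. \<phi> (c m t))"
      using assms(1) by (simp add: n)
    also have "\<dots> \<le> real n * \<Gamma>"
      by (rule cost[OF that])
    finally show ?thesis
      using \<open>n \<ge> 1\<close> by (simp add: cost_constraint_def field_simps)
  qed
  ultimately show ?thesis
    using dec by (simp add: is_code_def inputs_codebook)
qed

lemma recharge_adjacent:
  assumes "range \<phi> \<subseteq> E" "\<phi> x0 = 0"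
  shows "recharge \<phi> \<in> adjacent_chargers E n k"
proof -
  have "0 \<in> E"
    using assms by (metis range_subsetD)
  then have "\<forall>t<n. \<forall>xs. length xs = t \<longrightarrow> (if t = 0 then 0 else \<phi> (xs ! (t - 1))) \<in> E"
    using assms(1) by auto
  then show ?thesis
    unfolding adjacent_chargers_def recharge_def by blast
qed

lemma sum_cost_le:
  assumes "energy_constraint \<phi> Bmax n es xs" "cost_constraint \<Gamma> n es" "n \<ge> 1"
  shows "(\<Sum>t<n. \<phi> (xs ! t)) \<le> Bmax + real n * \<Gamma>"
proof -
  \<comment> \<open>An inequality rather than an equation, since energy above the battery capacity
    is lost.\<close>
  have balance: "(\<Sum>s<t. \<phi> (xs ! s)) \<le> Bmax + (\<Sum>s<t. es ! s) - battery \<phi> Bmax es xs t" for t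
    by (induction t) auto
  obtain n' where n: "n = Suc n'"
    using \<open>n \<ge> 1\<close> by (cases n) auto
  \<comment> \<open>This is the energy constraint at the last index, hence the splitting of
    \<open>n\<close> as a successor.\<close>
  have "0 \<le> battery \<phi> Bmax es xs n"
    using assms(1) by (simp add: n energy_constraint_def)
  moreover have "(\<Sum>s<n. es ! s) \<le> real n * \<Gamma>"
    using assms(2,3) by (simp add: cost_constraint_def field_simps)
  ultimately show ?thesis
    using balance[of n] by linarith
qed

subsection \<open>Achievability\<close>

lemma num_messages_ge_1: "num_messages R n \<ge> 1"
proof -
  have "0 < \<lceil>2 powr (real n * R)\<rceil>"
    by simp
  then show ?thesis
    unfolding num_messages_def by linarith
qed

lemma num_messages_le: "real (num_messages R n) \<le> exp (real n * (R * ln 2)) + 1"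
proof -
  have "real (num_messages R n) = real_of_int \<lceil>2 powr (real n * R)\<rceil>"
    unfolding num_messages_def by (simp add: less_imp_le)
  also have "\<dots> \<le> 2 powr (real n * R) + 1"
    by linarith
  finally show ?thesis
    by (simp add: powr_def mult_ac)
qed

lemma ln_num_messages_ge: "real n * (R * ln 2) \<le> ln (real (num_messages R n))"
proof -
  have "2 powr (real n * R) \<le> real (num_messages R n)"
    unfolding num_messages_def by linarith
  then have "ln (2 powr (real n * R)) \<le> ln (real (num_messages R n))"
    by (intro ln_mono) auto
  then show ?thesis
    by (simp add: ln_powr mult_ac)
qed

lemma expectation_joint:
  fixes W :: "'x::finite \<Rightarrow> 'y::finite pmf" and f :: "'x \<times> 'y \<Rightarrow> real"
  shows "measure_pmf.expectation (bind_pmf p (\<lambda>x. map_pmf (Pair x) (W x))) f =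
    measure_pmf.expectation p (\<lambda>x. measure_pmf.expectation (W x) (\<lambda>y. f (x, y)))"
  by (subst pmf_expectation_bind[of UNIV]) (auto simp: expectation_finite[of p])

text \<open>A low information sum is a large deviation from the mean, and so is excessive cost when
  the mean cost has strict slack. The second alternative in \<open>cost\<close> serves
  \<open>\<Gamma> = 0\<close>, where a nonnegative cost leaves no slack but holds with
  certainty.\<close>

lemma good_event_tendsto_1:
  fixes W :: "'x::finite \<Rightarrow> 'y::finite pmf" and p :: "'x pmf" and \<phi> :: "'x \<Rightarrow> real"
  assumes r: "r < channel_information W p * ln 2"
    and cost: "measure_pmf.expectation p \<phi> < \<Gamma> \<or> (\<forall>x\<in>set_pmf p. \<phi> x \<le> \<Gamma>)"
  shows "(\<lambda>n. measure_pmf.prob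
      (Pi_pmf {..<n} (undefined, undefined) (\<lambda>_. bind_pmf p (\<lambda>x. map_pmf (Pair x) (W x))))
      {z. fst \<circ> z \<in> {x. (\<Sum>t<n. \<phi> (x t)) \<le> real n * \<Gamma>} \<and>
        real n * r \<le> (\<Sum>t<n. info_density W (bind_pmf p W) (fst (z t)) (snd (z t)))}) \<longlonglongrightarrow> 1"
    (is "(\<lambda>n. measure_pmf.prob (?M n) (?good n)) \<longlonglongrightarrow> 1")
proof -
  let ?J = "bind_pmf p (\<lambda>x. map_pmf (Pair x) (W x))"
  let ?i = "\<lambda>z. info_density W (bind_pmf p W) (fst z) (snd z)"
  let ?low = "\<lambda>n. {z :: nat \<Rightarrow> 'x \<times> 'y. (\<Sum>t<n. ?i (z t)) < real n * r}"
  let ?exp = "\<lambda>n. {z :: nat \<Rightarrow> 'x \<times> 'y. real n * \<Gamma> < (\<Sum>t<n. \<phi> (fst (z t)))}"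
  have low: "(\<lambda>n. measure_pmf.prob (?M n) (?low n)) \<longlonglongrightarrow> 0"
  proof -
    let ?d = "channel_information W p * ln 2 - r"
    have E: "measure_pmf.expectation ?J ?i = channel_information W p * ln 2"
      by (simp add: expectation_joint channel_information_expectation)
    have "measure_pmf.prob (?M n) (?low n) \<le> measure_pmf.prob (?M n)
        {z. real n * ?d \<le> \<bar>(\<Sum>t<n. ?i (z t)) - real n * measure_pmf.expectation ?J ?i\<bar>}" for n
      unfolding E by (intro measure_pmf.finite_measure_mono) (auto simp: algebra_simps)
    then show ?thesis
      using r by (intro Lim_null_comparison[OF _ prob_deviation_tendsto_0[of ?d "(undefined, undefined)" ?J ?i]]) auto
  qed
  have exp: "(\<lambda>n. measure_pmf.prob (?M n) (?exp n)) \<longlonglongrightarrow> 0"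
    using cost
  proof
    assume less: "measure_pmf.expectation p \<phi> < \<Gamma>"
    let ?d = "\<Gamma> - measure_pmf.expectation p \<phi>"
    have E: "measure_pmf.expectation ?J (\<lambda>z. \<phi> (fst z)) = measure_pmf.expectation p \<phi>"
      by (simp add: expectation_joint)
    have "measure_pmf.prob (?M n) (?exp n) \<le> measure_pmf.prob (?M n)
        {z. real n * ?d \<le> \<bar>(\<Sum>t<n. \<phi> (fst (z t))) -
          real n * measure_pmf.expectation ?J (\<lambda>z. \<phi> (fst z))\<bar>}" for n
      unfolding E by (intro measure_pmf.finite_measure_mono) (auto simp: algebra_simps)
    then show ?thesis
      using less
      by (intro Lim_null_comparison[OF _ prob_deviation_tendsto_0[of ?d "(undefined, undefined)" ?J "\<lambda>z. \<phi> (fst z)"]]) auto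
  next
    assume le: "\<forall>x\<in>set_pmf p. \<phi> x \<le> \<Gamma>"
    have "z \<notin> ?exp n" if "z \<in> set_pmf (?M n)" for z n
    proof -
      have "(\<Sum>t<n. \<phi> (fst (z t))) \<le> (\<Sum>t<n. \<Gamma>)"
        using that le by (intro sum_mono) (auto simp: set_Pi_pmf PiE_dflt_def)
      then show ?thesis
        by simp
    qed
    then have "measure_pmf.prob (?M n) (?exp n) = 0" for n
      by (subst measure_pmf_zero_iff) blast
    then show ?thesis
      by simp
  qed
  have lower: "1 - (measure_pmf.prob (?M n) (?low n) + measure_pmf.prob (?M n) (?exp n)) \<le>
      measure_pmf.prob (?M n) (?good n)" for n
  proof -
    have "measure_pmf.prob (?M n) (- ?good n) \<le> measure_pmf.prob (?M n) (?low n \<union> ?exp n)"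
      by (intro measure_pmf.finite_measure_mono) (auto simp: o_def)
    also have "\<dots> \<le> measure_pmf.prob (?M n) (?low n) + measure_pmf.prob (?M n) (?exp n)"
      by (rule measure_Un_le) auto
    finally show ?thesis
      using measure_pmf.prob_compl[of "?good n" "?M n"] by (simp add: Compl_eq_Diff_UNIV)
  qed
  show ?thesis
  proof (rule tendsto_sandwich[OF _ _ _ tendsto_const[of 1]])
    show "\<forall>\<^sub>F n in sequentially. 1 - (measure_pmf.prob (?M n) (?low n) + measure_pmf.prob (?M n) (?exp n))
        \<le> measure_pmf.prob (?M n) (?good n)"
      by (rule always_eventually) (use lower in blast)
    show "(\<lambda>n. 1 - (measure_pmf.prob (?M n) (?low n) + measure_pmf.prob (?M n) (?exp n)))
        \<longlonglongrightarrow> 1"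
      using tendsto_diff[OF tendsto_const[of 1] tendsto_add[OF low exp]] by simp
    show "\<forall>\<^sub>F n in sequentially. measure_pmf.prob (?M n) (?good n) \<le> 1"
      by (rule always_eventually) (rule allI, rule measure_pmf.prob_le_1)
  qed
qed

lemma achievable_recharge:
  fixes W :: "'x::finite \<Rightarrow> 'y::finite pmf" and c :: "nat \<Rightarrow> nat \<Rightarrow> nat \<Rightarrow> 'x"
  assumes \<phi>: "\<And>x. 0 \<le> \<phi> x" "\<And>x. \<phi> x \<le> Bmax" "\<phi> x0 = 0" "range \<phi> \<subseteq> E"
    and "R \<ge> 0"
    and cost: "\<And>n m. n \<ge> 1 \<Longrightarrow> m \<in> {1..num_messages R n} \<Longrightarrow> (\<Sum>t<n. \<phi> (c n m t)) \<le> real n * \<Gamma>"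
    and dec: "\<And>n ys. n \<ge> 1 \<Longrightarrow> dec n ys \<in> {1..num_messages R n}"
    and err: "\<And>n m. n \<ge> 1 \<Longrightarrow> m \<in> {1..num_messages R n} \<Longrightarrow>
      measure_pmf.prob (channel_output W n (map (c n m) [0..<n])) {ys. dec n ys \<noteq> m} \<le> \<epsilon> n"
    and \<epsilon>: "\<epsilon> \<longlonglongrightarrow> 0"
  shows "achievable W \<phi> Bmax (adjacent_chargers E) \<Gamma> R"
proof -
  let ?tx = "\<lambda>n. codebook_transmitter (c n)" and ?ch = "\<lambda>n::nat. recharge \<phi>"
  have "?ch n \<in> adjacent_chargers E n (num_messages R n)
      \<and> is_code \<phi> Bmax \<Gamma> n (num_messages R n) (?tx n) (?ch n) (dec n)" if "n \<ge> 1" for n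
    using that \<phi> by (intro conjI recharge_adjacent is_code_recharge cost dec) auto
  moreover have "(\<lambda>n. error_prob W n (num_messages R n) (?tx n) (?ch n) (dec n)) \<longlonglongrightarrow> 0"
  proof (rule tendsto_sandwich[OF _ _ tendsto_const \<epsilon>])
    show "\<forall>\<^sub>F n in sequentially. 0 \<le> error_prob W n (num_messages R n) (?tx n) (?ch n) (dec n)"
      by (auto simp: error_prob_def intro!: always_eventually divide_nonneg_nonneg sum_nonneg)
    show "\<forall>\<^sub>F n in sequentially. error_prob W n (num_messages R n) (?tx n) (?ch n) (dec n) \<le> \<epsilon> n"
    proof (rule eventually_sequentiallyI[of 1])
      fix n :: nat assume n: "1 \<le> n"
      let ?k = "num_messages R n"
      have "(\<Sum>m=1..?k. measure_pmf.prob (channel_output W n (inputs (?tx n) (?ch n) n m)) {ys. dec n ys \<noteq> m})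
          \<le> (\<Sum>m=1..?k. \<epsilon> n)"
        unfolding inputs_codebook by (intro sum_mono err n) auto
      then show "error_prob W n ?k (?tx n) (?ch n) (dec n) \<le> \<epsilon> n"
        using num_messages_ge_1[of R n] by (simp add: error_prob_def field_simps)
    qed
  qed
  ultimately show ?thesis
    using \<open>R \<ge> 0\<close> unfolding achievable_def
    by (intro conjI exI[of _ ?tx] exI[of _ ?ch] exI[of _ dec]) auto
qed

text \<open>At rate 0 there is a single message, so repeating the free symbol and always decoding 1
  makes no error.\<close>

lemma achievable_0:
  fixes W :: "'x::finite \<Rightarrow> 'y::finite pmf"
  assumes "\<And>x. 0 \<le> \<phi> x" "\<And>x. \<phi> x \<le> Bmax" "\<phi> x0 = 0" "range \<phi> \<subseteq> E" "0 \<le> \<Gamma>"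
  shows "achievable W \<phi> Bmax (adjacent_chargers E) \<Gamma> 0"
  by (rule achievable_recharge[where c = "\<lambda>_ _ _. x0" and dec = "\<lambda>_ _. 1" and \<epsilon> = "\<lambda>_. 0" and ?x0.0 = x0])
    (use assms in \<open>auto simp: num_messages_def\<close>)

lemma achievable_below_information:
  fixes W :: "'x::finite \<Rightarrow> 'y::finite pmf"
  assumes \<phi>: "\<And>x. 0 \<le> \<phi> x" "\<And>x. \<phi> x \<le> Bmax" "\<phi> x0 = 0" "range \<phi> \<subseteq> E"
    and "0 \<le> \<Gamma>" "0 \<le> R" and R: "R < channel_information W p"
    and cost: "measure_pmf.expectation p \<phi> < \<Gamma> \<or> (\<forall>x\<in>set_pmf p. \<phi> x \<le> \<Gamma>)"
  shows "achievable W \<phi> Bmax (adjacent_chargers E) \<Gamma> R"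
proof -
  define s where "s = R * ln 2"
  have "s < channel_information W p * ln 2"
    using R by (simp add: s_def)
  \<comment> \<open>The threshold per symbol lies below the information, so the good event is
    likely, and above the rate in nats, so the number of messages times
    \<open>exp (- (real n * r))\<close> vanishes.\<close>
  then obtain r where r: "s < r" "r < channel_information W p * ln 2"
    using dense by blast
  have "0 \<le> s"
    using \<open>0 \<le> R\<close> by (simp add: s_def)
  let ?k = "num_messages R"
  define A where "A n = {x :: nat \<Rightarrow> 'x. (\<Sum>t<n. \<phi> (x t)) \<le> real n * \<Gamma>}" for n
  define g where "g n = measure_pmf.prob
      (Pi_pmf {..<n} (undefined, undefined) (\<lambda>_. bind_pmf p (\<lambda>x. map_pmf (Pair x) (W x))))
      {z. fst \<circ> z \<in> A n \<and>
        real n * r \<le> (\<Sum>t<n. info_density W (bind_pmf p W) (fst (z t)) (snd (z t)))}" for n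
  have g: "g \<longlonglongrightarrow> 1"
    unfolding g_def A_def by (rule good_event_tendsto_1[OF r(2) cost])
  \<comment> \<open>The last summand only makes the inequality required by Feinstein's construction strict.\<close>
  define \<epsilon> where "\<epsilon> n = 1 - g n + real (?k n) * exp (- (real n * r)) + 1 / real (Suc n)" for n
  have "\<exists>c dec. (\<forall>m\<in>{1..?k n}. c m \<in> A n \<and>
      measure_pmf.prob (channel_output W n (map (c m) [0..<n])) {ys. dec ys \<noteq> m} \<le> \<epsilon> n) \<and>
    (\<forall>ys. dec ys \<in> {1..?k n})" for n
  proof (rule block_code_exists[where p = p and \<tau> = "real n * r"])
    have "(\<lambda>_. x0) \<in> A n"
      using \<phi>(3) \<open>0 \<le> \<Gamma>\<close> by (simp add: A_def)
    then show "A n \<noteq> {}"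
      by blast
    show "1 - \<epsilon> n + real (?k n) * exp (- (real n * r)) < measure_pmf.prob
      (Pi_pmf {..<n} (undefined, undefined) (\<lambda>_. bind_pmf p (\<lambda>x. map_pmf (Pair x) (W x))))
      {z. fst \<circ> z \<in> A n \<and>
        real n * r \<le> (\<Sum>t<n. info_density W (bind_pmf p W) (fst (z t)) (snd (z t)))}"
      unfolding g_def[symmetric] by (simp add: \<epsilon>_def)
  qed (rule num_messages_ge_1)
  then obtain c dec where c: "\<And>n m. m \<in> {1..?k n} \<Longrightarrow> c n m \<in> A n \<and>
      measure_pmf.prob (channel_output W n (map (c n m) [0..<n])) {ys. dec n ys \<noteq> m} \<le> \<epsilon> n"
    and dec: "\<And>n ys. dec n ys \<in> {1..?k n}"
    by metis
  have "\<epsilon> \<longlonglongrightarrow> 0"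
  proof -
    have exp_lim: "(\<lambda>n. exp (- (real n * a))) \<longlonglongrightarrow> 0" if "a > 0" for a
      using that by real_asymp
    \<comment> \<open>Rounding up adds at most one message, which accounts for the second summand;
      it vanishes because \<open>r > s \<ge> 0\<close>.\<close>
    have "real (?k n) * exp (- (real n * r)) \<le> exp (- (real n * (r - s))) + exp (- (real n * r))" for n
    proof -
      have "real (?k n) * exp (- (real n * r)) \<le> (exp (real n * s) + 1) * exp (- (real n * r))"
        unfolding s_def by (intro mult_right_mono num_messages_le) auto
      also have "\<dots> = exp (- (real n * (r - s))) + exp (- (real n * r))"
        by (simp add: distrib_right mult_exp_exp right_diff_distrib)
      finally show ?thesis .
    qed
    then have K: "norm (real (?k n) * exp (- (real n * r))) \<le>
        exp (- (real n * (r - s))) + exp (- (real n * r))" for n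
      by (simp add: abs_mult)
    have "(\<lambda>n. exp (- (real n * (r - s))) + exp (- (real n * r))) \<longlonglongrightarrow> 0 + 0"
      by (intro tendsto_add exp_lim) (use r \<open>0 \<le> s\<close> in auto)
    then have L: "(\<lambda>n. exp (- (real n * (r - s))) + exp (- (real n * r))) \<longlonglongrightarrow> 0"
      by simp
    have "(\<lambda>n. real (?k n) * exp (- (real n * r))) \<longlonglongrightarrow> 0"
      by (rule Lim_null_comparison[OF always_eventually[OF allI[OF K]] L])
    moreover have "(\<lambda>n. 1 / real (Suc n)) \<longlonglongrightarrow> 0"
      by real_asymp
    ultimately have "\<epsilon> \<longlonglongrightarrow> 1 - 1 + 0 + 0"
      unfolding \<epsilon>_def by (intro tendsto_add tendsto_diff tendsto_const g)
    then show ?thesis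
      by simp
  qed
  then show ?thesis
    using \<phi> \<open>0 \<le> R\<close> c dec
    by (intro achievable_recharge[of \<phi> Bmax x0 E R c \<Gamma> dec W \<epsilon>]) (auto simp: A_def)
qed

lemma information_le_C_X:
  fixes W :: "'x::finite \<Rightarrow> 'y::finite pmf"
  assumes \<phi>: "\<And>x. 0 \<le> \<phi> x" "\<And>x. \<phi> x \<le> Bmax" "\<phi> x0 = 0" "range \<phi> \<subseteq> E" and "0 \<le> \<Gamma>"
    and cost: "measure_pmf.expectation p \<phi> < \<Gamma> \<or> (\<forall>x\<in>set_pmf p. \<phi> x \<le> \<Gamma>)"
  shows "ereal (channel_information W p) \<le> C_X W \<phi> Bmax E \<Gamma>"
proof (rule dense_le)
  fix a :: ereal
  assume a: "a < ereal (channel_information W p)"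
  have le: "ereal R \<le> C_X W \<phi> Bmax E \<Gamma>" if "achievable W \<phi> Bmax (adjacent_chargers E) \<Gamma> R" for R
    using that unfolding C_X_def capacity_def by (intro SUP_upper) simp
  \<comment> \<open>Achievable rates are nonnegative by definition, so nonpositive \<open>a\<close>
    are handled by rate 0.\<close>
  show "a \<le> C_X W \<phi> Bmax E \<Gamma>"
  proof (cases "a \<le> 0")
    case True
    also have "0 \<le> C_X W \<phi> Bmax E \<Gamma>"
      using le[OF achievable_0[OF \<phi> \<open>0 \<le> \<Gamma>\<close>]] by (simp add: zero_ereal_def)
    finally show ?thesis .
  next
    case False
    with a obtain R where R: "a = ereal R" "0 \<le> R" "R < channel_information W p"
      by (cases a) (auto simp: zero_ereal_def)
    show ?thesis
      unfolding R(1) using achievable_below_information[OF \<phi> \<open>0 \<le> \<Gamma>\<close> R(2,3) cost] by (rule le)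
  qed
qed

text \<open>A law that meets the cost bound with equality has no slack for the law of large numbers.
  Mixing in the free symbol creates slack, and continuity recovers the original information in the
  limit.\<close>

lemma C_ub_le_C_X:
  fixes W :: "'x::finite \<Rightarrow> 'y::finite pmf"
  assumes \<phi>: "\<And>x. 0 \<le> \<phi> x" "\<And>x. \<phi> x \<le> Bmax" "\<phi> x0 = 0" "range \<phi> \<subseteq> E" and "0 \<le> \<Gamma>"
  shows "C_ub W \<phi> \<Gamma> \<le> C_X W \<phi> Bmax E \<Gamma>"
  unfolding C_ub_def
proof (rule SUP_least)
  fix p assume "p \<in> input_distributions \<phi> \<Gamma>"
  then have p: "measure_pmf.expectation p \<phi> \<le> \<Gamma>"
    by (simp add: input_distributions_def)
  define s where "s n = 1 - 1 / real (n + 2)" for n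
  have s: "0 < s n" "s n < 1" for n
    by (auto simp: s_def)
  have lim_s: "s \<longlonglongrightarrow> 1"
    unfolding s_def by real_asymp
  define mix where "mix n = bind_pmf (bernoulli_pmf (s n)) (\<lambda>b. if b then p else return_pmf x0)" for n
  have E_mix: "measure_pmf.expectation (mix n) f = s n * measure_pmf.expectation p f + (1 - s n) * f x0"
    for n and f :: "'x \<Rightarrow> real"
    unfolding mix_def using s[of n] by (subst pmf_expectation_bind[of UNIV]) (auto simp: UNIV_bool)
  have set_mix: "set_pmf (mix n) \<subseteq> insert x0 (set_pmf p)" for n
    by (auto simp: mix_def split: if_splits)
  obtain l r where r: "strict_mono r"
    and lim_E: "\<And>f :: 'x \<Rightarrow> real. (\<lambda>n. measure_pmf.expectation (mix (r n)) f) \<longlonglongrightarrow> measure_pmf.expectation l f"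
    and lim_I: "(\<lambda>n. channel_information W (mix (r n))) \<longlonglongrightarrow> channel_information W l"
    using pmf_convergent_subseq[of mix W] by metis
  \<comment> \<open>Identifies the subsequential limit of the mixtures as \<open>p\<close>: their
    expectations converge to those of \<open>p\<close>, and indicators then give equal point
    masses.\<close>
  have "measure_pmf.expectation l f = measure_pmf.expectation p f" for f :: "'x \<Rightarrow> real"
  proof (rule LIMSEQ_unique[OF lim_E])
    have "(\<lambda>n. s (r n)) \<longlonglongrightarrow> 1"
      using LIMSEQ_subseq_LIMSEQ[OF lim_s r] by (simp add: o_def)
    then have "(\<lambda>n. s (r n) * measure_pmf.expectation p f + (1 - s (r n)) * f x0)
        \<longlonglongrightarrow> 1 * measure_pmf.expectation p f + (1 - 1) * f x0"
      by (intro tendsto_intros)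
    then show "(\<lambda>n. measure_pmf.expectation (mix (r n)) f) \<longlonglongrightarrow> measure_pmf.expectation p f"
      by (simp add: E_mix)
  qed
  from this[of "indicator {_}"] have "l = p"
    by (intro pmf_eqI) (simp add: measure_pmf_single)
  have "ereal (channel_information W (mix n)) \<le> C_X W \<phi> Bmax E \<Gamma>" for n
  proof (rule information_le_C_X[OF \<phi> \<open>0 \<le> \<Gamma>\<close>])
    show "measure_pmf.expectation (mix n) \<phi> < \<Gamma> \<or> (\<forall>x\<in>set_pmf (mix n). \<phi> x \<le> \<Gamma>)"
    proof (cases "\<Gamma> = 0")
      case True
      \<comment> \<open>With zero budget, \<open>p\<close> is supported on free symbols, and so is
        the mixture.\<close>
      have "(\<Sum>x\<in>UNIV. pmf p x * \<phi> x) = 0"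
        using p \<phi>(1) True by (intro antisym sum_nonneg) (auto simp: expectation_finite)
      then have "\<phi> x = 0" if "x \<in> set_pmf p" for x
        using that \<phi>(1) by (subst (asm) sum_nonneg_eq_0_iff) (auto simp: set_pmf_iff)
      then show ?thesis
        using set_mix[of n] \<phi>(3) True by auto
    next
      case False
      have "measure_pmf.expectation (mix n) \<phi> \<le> s n * \<Gamma>"
        using p s[of n] by (simp add: E_mix \<phi>(3))
      also have "\<dots> < \<Gamma>"
        using False \<open>0 \<le> \<Gamma>\<close> s[of n] by simp
      finally show ?thesis
        by simp
    qed
  qed
  then have le: "\<exists>N. \<forall>n\<ge>N. ereal (channel_information W (mix (r n))) \<le> C_X W \<phi> Bmax E \<Gamma>"
    by blast
  have "(\<lambda>n. ereal (channel_information W (mix (r n)))) \<longlonglongrightarrow> ereal (channel_information W p)"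
    using lim_I unfolding \<open>l = p\<close> by (rule tendsto_ereal)
  then show "ereal (channel_information W p) \<le> C_X W \<phi> Bmax E \<Gamma>"
    using le by (rule LIMSEQ_le_const2)
qed

subsection \<open>Converse\<close>

definition symbol_distribution :: "nat \<Rightarrow> nat \<Rightarrow> (nat \<Rightarrow> 'x list) \<Rightarrow> 'x pmf" where
  "symbol_distribution k n xs = map_pmf (\<lambda>(m, t). xs m ! t) (pmf_of_set ({1..k} \<times> {..<n}))"

lemma
  assumes "k \<ge> 1" "n \<ge> 1"
  shows set_symbol_distribution:
      "set_pmf (symbol_distribution k n xs) = (\<lambda>(m, t). xs m ! t) ` ({1..k} \<times> {..<n})"
    and expectation_symbol_distribution:
      "measure_pmf.expectation (symbol_distribution k n xs) f =
        (\<Sum>m=1..k. \<Sum>t<n. f (xs m ! t)) / (real k * real n)"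
proof -
  have ne: "{1..k} \<times> {..<n} \<noteq> {}"
    using assms by (auto simp: lessThan_empty_iff)
  show "set_pmf (symbol_distribution k n xs) = (\<lambda>(m, t). xs m ! t) ` ({1..k} \<times> {..<n})"
    unfolding symbol_distribution_def using ne by (subst set_map_pmf, subst set_pmf_of_set) auto
  show "measure_pmf.expectation (symbol_distribution k n xs) f =
        (\<Sum>m=1..k. \<Sum>t<n. f (xs m ! t)) / (real k * real n)"
    unfolding symbol_distribution_def using ne
    by (simp add: integral_pmf_of_set case_prod_unfold sum.cartesian_product)
qed

text \<open>
  A variational form of Fano's inequality: the function \<open>f\<close> below, \<open>ln k\<close> on correct decoding minus
  the information density of the word, has \<open>E (exp f) \<le> 2\<close> under the code, because \<open>exp\<close> of minus
  the density changes the channel law into the product law \<open>Q\<close>, which is independent of the message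
  and so decodes correctly with probability at most \<open>1 / k\<close>. Then \<open>f \<le> ln 2 - 1 + exp f / 2\<close> gives
  \<open>E f \<le> ln 2\<close>.
\<close>

lemma converse_bound:
  fixes W :: "'x::finite \<Rightarrow> 'y::finite pmf" and xs :: "nat \<Rightarrow> 'x list" and dec :: "'y list \<Rightarrow> nat"
  assumes "k \<ge> 1" "n \<ge> 1"
  defines "p \<equiv> symbol_distribution k n xs"
  shows "(1 - (1 / real k) * (\<Sum>m=1..k. measure_pmf.prob (channel_output W n (xs m)) {ys. dec ys \<noteq> m}))
      * ln (real k) \<le> real n * (channel_information W p * ln 2) + ln 2"
proof -
  define q where "q = bind_pmf p W"
  define i where "i = info_density W q"
  define V where "V m = Pi_pmf {..<n} undefined (\<lambda>t. W (xs m ! t))" for m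
  define Q where "Q = Pi_pmf {..<n} undefined (\<lambda>_. q)"
  define A where "A m = {y. dec (map y [0..<n]) = m}" for m
  \<comment> \<open>A finite set carrying the channel laws of all codewords as well as
    \<open>Q\<close>, so expectations become finite sums that can be compared termwise.\<close>
  define S where "S = PiE_dflt {..<n} (undefined :: 'y) (\<lambda>_. UNIV)"
  define w where "w m y = (if y \<in> A m then real k else 1)" for m y
  define f where "f m y = ln (w m y) - (\<Sum>t<n. i (xs m ! t) (y t))" for m y
  have "finite S"
    unfolding S_def by (rule finite_PiE_dflt) auto
  have V_S: "set_pmf (V m) \<subseteq> S" for m
    by (auto simp: V_def S_def set_Pi_pmf PiE_dflt_def)
  have Q_S: "set_pmf Q \<subseteq> S"
    by (auto simp: Q_def S_def set_Pi_pmf PiE_dflt_def)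
  have int: "integrable (measure_pmf (V m)) (g :: _ \<Rightarrow> real)" for m g
    by (rule integrable_measure_pmf_finite) (rule finite_subset[OF V_S \<open>finite S\<close>])
  have intQ: "integrable (measure_pmf Q) (g :: _ \<Rightarrow> real)" for g
    by (rule integrable_measure_pmf_finite) (rule finite_subset[OF Q_S \<open>finite S\<close>])
  have w_pos: "w m y > 0" for m y
    using \<open>k \<ge> 1\<close> by (simp add: w_def)
  \<comment> \<open>The change of measure is an equality on the support of \<open>V m\<close>; off
    it the left side is 0.\<close>
  have pointwise: "exp (f m y) * pmf (V m) y \<le> w m y * pmf Q y" if m: "m \<in> {1..k}" for m y
  proof (cases "y \<in> set_pmf (V m)")
    case False
    then show ?thesis
      using w_pos[of m y] by (simp add: pmf_eq_0_set_pmf[symmetric])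
  next
    case True
    then have y: "y t \<in> set_pmf (W (xs m ! t))" if "t < n" for t
      using that by (auto simp: V_def set_Pi_pmf PiE_dflt_def)
    have y0: "y t = undefined" if "\<not> t < n" for t
      using True that by (auto simp: V_def set_Pi_pmf PiE_dflt_def)
    \<comment> \<open>Every code symbol has positive weight in the empirical law, so
      \<open>q\<close> is positive wherever the channel can take a codeword, and no density is
      infinite.\<close>
    have "xs m ! t \<in> set_pmf p" if "t < n" for t
      using that m assms(1,2) by (force simp: p_def set_symbol_distribution)
    then have pos: "0 < pmf (W (xs m ! t)) (y t)" "0 < pmf q (y t)" if "t < n" for t
      using y[OF that] that by (auto simp: q_def pmf_positive_iff)
    have VV: "pmf (V m) y = (\<Prod>t<n. pmf (W (xs m ! t)) (y t))"
      unfolding V_def using y0 by (subst pmf_Pi') auto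
    have QQ: "pmf Q y = (\<Prod>t<n. pmf q (y t))"
      unfolding Q_def using y0 by (subst pmf_Pi') auto
    have "exp (\<Sum>t<n. i (xs m ! t) (y t)) * pmf Q y = pmf (V m) y"
      unfolding QQ VV exp_sum[OF finite_lessThan] prod.distrib[symmetric]
      using pos by (intro prod.cong) (auto simp: i_def info_density_def less_imp_neq[symmetric])
    moreover have "exp (f m y) = w m y / exp (\<Sum>t<n. i (xs m ! t) (y t))"
      using w_pos[of m y] by (simp add: f_def exp_diff)
    ultimately have "exp (f m y) * pmf (V m) y = w m y * pmf Q y"
      by (simp flip: \<open>exp _ * pmf Q y = _\<close>)
    then show ?thesis
      by simp
  qed
  have bound_f: "measure_pmf.expectation (V m) (f m) \<le>
      (ln 2 - 1 / 2) + real k / 2 * measure_pmf.prob Q (A m)" if m: "m \<in> {1..k}" for m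
  proof -
    \<comment> \<open>The tangent of \<open>exp\<close> at 0, evaluated at
      \<open>f m y - ln 2\<close>.\<close>
    have "f m y \<le> ln 2 - 1 + exp (f m y) / 2" for y
      using exp_ge_add_one_self[of "f m y - ln 2"] by (simp add: exp_diff)
    then have "measure_pmf.expectation (V m) (f m) \<le>
        measure_pmf.expectation (V m) (\<lambda>y. ln 2 - 1 + exp (f m y) / 2)"
      by (intro integral_mono int)
    also have "\<dots> = ln 2 - 1 + measure_pmf.expectation (V m) (\<lambda>y. exp (f m y)) / 2"
      using int by simp
    also have "measure_pmf.expectation (V m) (\<lambda>y. exp (f m y)) = (\<Sum>y\<in>S. exp (f m y) * pmf (V m) y)"
      by (rule integral_measure_pmf_real) (use \<open>finite S\<close> V_S in auto)
    also have "\<dots> \<le> (\<Sum>y\<in>S. w m y * pmf Q y)"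
      by (intro sum_mono pointwise m)
    also have "\<dots> = measure_pmf.expectation Q (w m)"
      by (rule integral_measure_pmf_real[symmetric]) (use \<open>finite S\<close> Q_S in auto)
    also have "\<dots> \<le> measure_pmf.expectation Q (\<lambda>y. 1 + real k * indicator (A m) y)"
      by (intro integral_mono intQ) (auto simp: w_def)
    also have "\<dots> = 1 + real k * measure_pmf.prob Q (A m)"
      using intQ by simp
    finally show ?thesis
      by (simp add: field_simps)
  qed
  have E_f: "measure_pmf.expectation (V m) (f m) =
      (1 - measure_pmf.prob (channel_output W n (xs m)) {ys. dec ys \<noteq> m}) * ln (real k) -
      (\<Sum>t<n. measure_pmf.expectation (W (xs m ! t)) (i (xs m ! t)))" for m
  proof -
    have "ln (w m y) = ln (real k) * indicator (A m) y" for y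
      by (simp add: w_def)
    then have "measure_pmf.expectation (V m) (f m) = ln (real k) * measure_pmf.prob (V m) (A m) -
        (\<Sum>t<n. measure_pmf.expectation (V m) (\<lambda>y. i (xs m ! t) (y t)))"
      unfolding f_def using int by simp
    also have "(\<Sum>t<n. measure_pmf.expectation (V m) (\<lambda>y. i (xs m ! t) (y t))) =
        (\<Sum>t<n. measure_pmf.expectation (W (xs m ! t)) (i (xs m ! t)))"
      unfolding V_def by (intro sum.cong) (auto simp: expectation_Pi_pmf_component)
    also have "measure_pmf.prob (V m) (A m) =
        1 - measure_pmf.prob (channel_output W n (xs m)) {ys. dec ys \<noteq> m}"
      using measure_pmf.prob_compl[of "- A m" "V m"]
      by (simp add: channel_output_def V_def A_def vimage_def Compl_eq_Diff_UNIV[symmetric]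
          Collect_neg_eq[symmetric])
    finally show ?thesis
      by (simp add: mult.commute)
  qed
  \<comment> \<open>Exact because \<open>p\<close> is the empirical law of precisely these symbols
    and \<open>q\<close> is its output law.\<close>
  have info: "(\<Sum>m=1..k. \<Sum>t<n. measure_pmf.expectation (W (xs m ! t)) (i (xs m ! t))) =
      real k * (real n * (channel_information W p * ln 2))"
    using assms(1,2)
    unfolding channel_information_expectation q_def[symmetric] i_def[symmetric]
    by (simp add: p_def expectation_symbol_distribution)
  have "(\<Sum>m=1..k. measure_pmf.expectation (V m) (f m)) \<le>
      (\<Sum>m=1..k. (ln 2 - 1 / 2) + real k / 2 * measure_pmf.prob Q (A m))"
    by (intro sum_mono bound_f)
  also have "\<dots> = real k * (ln 2 - 1 / 2) + real k / 2 * (\<Sum>m=1..k. measure_pmf.prob Q (A m))"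
    unfolding sum.distrib sum_distrib_left by simp
  also have "\<dots> \<le> real k * (ln 2 - 1 / 2) + real k / 2 * 1"
  proof (intro add_left_mono mult_left_mono)
    \<comment> \<open>The decoding regions are disjoint and \<open>Q\<close> is the same for all
      messages, so their total mass is at most 1.\<close>
    have "(\<Sum>m=1..k. measure_pmf.prob Q (A m)) = measure_pmf.prob Q (\<Union>m\<in>{1..k}. A m)"
      by (intro measure_pmf.finite_measure_finite_Union[symmetric])
        (auto simp: disjoint_family_on_def A_def)
    then show "(\<Sum>m=1..k. measure_pmf.prob Q (A m)) \<le> 1"
      by simp
  qed auto
  finally have "(\<Sum>m=1..k. measure_pmf.expectation (V m) (f m)) \<le> real k * ln 2"
    by (simp add: algebra_simps)
  then have "(\<Sum>m=1..k. 1 - measure_pmf.prob (channel_output W n (xs m)) {ys. dec ys \<noteq> m}) * ln (real k)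
      \<le> real k * (real n * (channel_information W p * ln 2) + ln 2)"
    unfolding E_f sum_subtractf info sum_distrib_right[symmetric] by (simp add: algebra_simps)
  then show ?thesis
    using \<open>k \<ge> 1\<close> by (simp add: sum_subtractf field_simps)
qed

text \<open>The argument rests on the energy and cost constraints of the codes, so one bound serves
  every class of chargers. The empirical laws exceed the budget by at most
  \<open>Bmax / real n\<close>; a subsequential limit meets it exactly and keeps the rate
  bound.\<close>

lemma converse:
  fixes W :: "'x::finite \<Rightarrow> 'y::finite pmf"
  assumes "achievable W \<phi> Bmax Ch \<Gamma> R"
  shows "\<exists>p\<in>input_distributions \<phi> \<Gamma>. R \<le> channel_information W p"
proof -
  from assms obtain tx ch dec where
    code: "\<And>n. n \<ge> 1 \<Longrightarrow> is_code \<phi> Bmax \<Gamma> n (num_messages R n) (tx n) (ch n) (dec n)"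
    and lim: "(\<lambda>n. error_prob W n (num_messages R n) (tx n) (ch n) (dec n)) \<longlonglongrightarrow> 0"
    unfolding achievable_def by blast
  let ?k = "num_messages R"
  define e where "e n = error_prob W n (?k n) (tx n) (ch n) (dec n)" for n
  define xs where "xs n = inputs (tx n) (ch n) n" for n
  define p where "p n = symbol_distribution (?k n) n (xs n)" for n
  have rate: "(1 - e n) * R \<le> channel_information W (p n) + 1 / real n" if "n \<ge> 1" "e n \<le> 1" for n
  proof -
    have "(1 - e n) * (real n * (R * ln 2)) \<le> (1 - e n) * ln (real (?k n))"
      using that by (intro mult_left_mono ln_num_messages_ge) auto
    also have "\<dots> \<le> real n * (channel_information W (p n) * ln 2) + ln 2"
      using converse_bound[of "?k n" n W "xs n" "dec n"] num_messages_ge_1[of R n] that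
      by (simp add: e_def error_prob_def p_def xs_def)
    also have "\<dots> = real n * ln 2 * (channel_information W (p n) + 1 / real n)"
      using that by (simp add: field_simps)
    finally have "real n * ln 2 * ((1 - e n) * R) \<le>
        real n * ln 2 * (channel_information W (p n) + 1 / real n)"
      by (simp add: mult_ac)
    then show ?thesis
      using that by (subst (asm) mult_le_cancel_left_pos) auto
  qed
  have cost: "measure_pmf.expectation (p n) \<phi> \<le> \<Gamma> + Bmax / real n" if "n \<ge> 1" for n
  proof -
    let ?k = "?k n"
    have "measure_pmf.expectation (p n) \<phi> = (\<Sum>m=1..?k. \<Sum>t<n. \<phi> (xs n m ! t)) / (real ?k * real n)"
      unfolding p_def using num_messages_ge_1 that by (rule expectation_symbol_distribution)
    also have "\<dots> \<le> (\<Sum>m=1..?k. Bmax + real n * \<Gamma>) / (real ?k * real n)"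
      unfolding xs_def
      by (intro divide_right_mono sum_mono sum_cost_le[where es = "energies (tx n) (ch n) n _"])
        (use code[OF that] that in \<open>auto simp: is_code_def\<close>)
    also have "\<dots> = \<Gamma> + Bmax / real n"
      using num_messages_ge_1[of R n] that by (simp add: field_simps)
    finally show ?thesis .
  qed
  obtain l r where r: "strict_mono r"
    and lim_E: "\<And>f :: 'x \<Rightarrow> real. (\<lambda>n. measure_pmf.expectation (p (r n)) f) \<longlonglongrightarrow> measure_pmf.expectation l f"
    and lim_I: "(\<lambda>n. channel_information W (p (r n))) \<longlonglongrightarrow> channel_information W l"
    using pmf_convergent_subseq[of p W] by metis
  have sub: "(\<lambda>n. g (r n)) \<longlonglongrightarrow> a" if "g \<longlonglongrightarrow> a" for g :: "nat \<Rightarrow> real" and a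
    using LIMSEQ_subseq_LIMSEQ[OF that r] by (simp add: o_def)
  \<comment> \<open>Codes are constrained only for positive blocklength, and the bounds divide by
    it.\<close>
  have ev: "\<forall>\<^sub>F n in sequentially. r n \<ge> 1"
    using r by (intro eventually_sequentiallyI[of 1]) (meson le_trans seq_suble)
  have e: "(\<lambda>n. e (r n)) \<longlonglongrightarrow> 0"
    using lim unfolding e_def[symmetric] by (rule sub)
  have inv: "(\<lambda>n. a / real (r n)) \<longlonglongrightarrow> 0" for a
    by (rule sub) real_asymp
  have "R \<le> channel_information W l"
  proof (rule tendsto_le[OF sequentially_bot])
    show "(\<lambda>n. channel_information W (p (r n)) + 1 / real (r n)) \<longlonglongrightarrow> channel_information W l"
      using tendsto_add[OF lim_I inv] by simp
    show "(\<lambda>n. (1 - e (r n)) * R) \<longlonglongrightarrow> R"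
      using tendsto_mult_right[OF tendsto_diff[OF tendsto_const[of 1] e], of R] by simp
    have "\<forall>\<^sub>F n in sequentially. e (r n) < 1"
      using order_tendstoD(2)[OF e, of 1] by simp
    with ev show "\<forall>\<^sub>F n in sequentially. (1 - e (r n)) * R \<le> channel_information W (p (r n)) + 1 / real (r n)"
      by eventually_elim (simp add: rate)
  qed
  moreover have "measure_pmf.expectation l \<phi> \<le> \<Gamma>"
  proof (rule tendsto_le[OF sequentially_bot _ lim_E])
    show "(\<lambda>n. \<Gamma> + Bmax / real (r n)) \<longlonglongrightarrow> \<Gamma>"
      using tendsto_add[OF tendsto_const inv] by simp
    show "\<forall>\<^sub>F n in sequentially. measure_pmf.expectation (p (r n)) \<phi> \<le> \<Gamma> + Bmax / real (r n)"
      using ev by eventually_elim (rule cost)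
  qed
  ultimately show ?thesis
    by (auto simp: input_distributions_def)
qed

section \<open>Attainment of the maximum\<close>

text \<open>A maximizing sequence has a subsequence whose laws converge and stay within the budget.
  Its information values converge to a real number, which must be the supremum; in particular the
  supremum is finite.\<close>

lemma C_ub_attained:
  fixes W :: "'x::finite \<Rightarrow> 'y::finite pmf"
  assumes "input_distributions \<phi> \<Gamma> \<noteq> {}"
  shows "\<exists>p\<in>input_distributions \<phi> \<Gamma>. ereal (channel_information W p) = C_ub W \<phi> \<Gamma>"
proof -
  let ?I = "\<lambda>p. ereal (channel_information W p)"
  obtain u where u: "range u \<subseteq> ?I ` input_distributions \<phi> \<Gamma>" "u \<longlonglongrightarrow> C_ub W \<phi> \<Gamma>"
    unfolding C_ub_def using Sup_countable_SUP[of "?I ` input_distributions \<phi> \<Gamma>"] assms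
    by (metis (no_types, lifting) LIMSEQ_SUP image_is_empty)
  then have "\<forall>n. \<exists>p\<in>input_distributions \<phi> \<Gamma>. u n = ?I p"
    by blast
  then obtain p where p: "\<And>n. p n \<in> input_distributions \<phi> \<Gamma>" "\<And>n. u n = ?I (p n)"
    by metis
  obtain l r where r: "strict_mono r"
    and lim_E: "\<And>f :: 'x \<Rightarrow> real. (\<lambda>n. measure_pmf.expectation (p (r n)) f) \<longlonglongrightarrow> measure_pmf.expectation l f"
    and lim_I: "(\<lambda>n. channel_information W (p (r n))) \<longlonglongrightarrow> channel_information W l"
    using pmf_convergent_subseq[of p W] by metis
  have "(\<lambda>n. ?I (p (r n))) \<longlonglongrightarrow> C_ub W \<phi> \<Gamma>"
    using LIMSEQ_subseq_LIMSEQ[OF u(2) r] by (simp add: o_def p(2))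
  then have "?I l = C_ub W \<phi> \<Gamma>"
    using lim_I by (metis LIMSEQ_unique lim_ereal)
  moreover have "measure_pmf.expectation l \<phi> \<le> \<Gamma>"
    using p(1) by (intro LIMSEQ_le_const2[OF lim_E]) (auto simp: input_distributions_def)
  ultimately show ?thesis
    by (auto simp: input_distributions_def)
qed

theorem theorem2:
  fixes W :: "'x::finite \<Rightarrow> 'y::finite pmf"
    and \<phi> :: "'x \<Rightarrow> real"
    and Bmax \<Gamma> :: real
    and E :: "real set"
  assumes "finite E"
    and "E \<subseteq> {0..Bmax}"
    and "\<exists>e\<in>E. e > 0"
    and "\<And>x. 0 \<le> \<phi> x"
    and "\<And>x. \<phi> x \<le> Bmax"
    and "\<exists>x. \<phi> x = 0"
    and precision_charger: "range \<phi> \<subseteq> E"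
    and "\<Gamma> \<ge> 0"
  shows "C_X W \<phi> Bmax E \<Gamma> = C_M W \<phi> Bmax E \<Gamma>
    \<and> C_M W \<phi> Bmax E \<Gamma> = C_ub W \<phi> \<Gamma>
    \<and> (\<exists>p\<in>input_distributions \<phi> \<Gamma>. ereal (channel_information W p) = C_ub W \<phi> \<Gamma>)"
proof -
  obtain x0 where x0: "\<phi> x0 = 0"
    using assms by blast
  \<comment> \<open>The equalities follow from a cycle of three inequalities: imitation, converse
    and achievability.\<close>
  have "C_X W \<phi> Bmax E \<Gamma> \<le> C_M W \<phi> Bmax E \<Gamma>"
    unfolding C_X_def C_M_def capacity_def
    by (rule SUP_subset_mono) (auto intro: achievable_cognitive_if_adjacent)
  moreover have "C_M W \<phi> Bmax E \<Gamma> \<le> C_ub W \<phi> \<Gamma>"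
    unfolding C_M_def capacity_def C_ub_def
    by (rule SUP_mono) (auto dest: converse)
  moreover have "C_ub W \<phi> \<Gamma> \<le> C_X W \<phi> Bmax E \<Gamma>"
    using assms x0 by (intro C_ub_le_C_X)
  moreover have "return_pmf x0 \<in> input_distributions \<phi> \<Gamma>"
    using x0 \<open>\<Gamma> \<ge> 0\<close> by (simp add: input_distributions_def)
  then have "\<exists>p\<in>input_distributions \<phi> \<Gamma>. ereal (channel_information W p) = C_ub W \<phi> \<Gamma>"
    by (intro C_ub_attained) blast
  ultimately show ?thesis
    by (meson antisym order_trans)
qed

end
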